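(* Let $N\ge 1$. Assume $f\in C^0([0,\infty))\cap C^2((0,\infty))$ is nondecreasing and convex, $f>0$ in $(0,\infty)$, and the limit $q_0=\lim_{u\to0^+}q(u)$ exists in $\overline{\mathbb{R}}$. Let $p_0$ be the conjugate exponent of $q_0$. Assume $u\in C^2(\mathbb{R}^N)$ is a bounded, nonnegative, stable solution of $-\Delta u=f(u)$ in $\mathbb{R}^N$. Then $u\equiv 0$ if any of the following conditions holds: 1. $1\le N\le 9$; 2. $N=10$ and $p_0<+\infty$; 3. $N\ge 11$ and $p_0<p_c(N)$.
   Context: For $u>0$, $q(u)=\dfrac{f'(u)^2}{f(u)f''(u)}$ if $f(u)f''(u)\ne0$, and $q(u)=+\infty$ otherwise. The conjugate exponent $p_0\in\overline{\mathbb{R}}$ of $q_0$ is defined by $1/p_0+1/q_0=1$, i.e. $p_0=q_0/(q_0-1)$ if $q_0\notin\{1,+\infty\}$, $p_0=+\infty$ if $q_0=1$, $p_0=1$ if $q_0=+\infty$. For $N\ge 11$, $p_c(N)=\dfrac{(N-2)^2-4N+8\sqrt{N-1}}{(N-2)(N-10)}$. A solution $u\in C^2(\mathbb{R}^N)$ of $-\Delta u=f(u)$ in $\mathbb{R}^N$ is stable if for all $\varphi\in C^1_c(\mathbb{R}^N)$, $\int_{\mathbb{R}^N} f'(u)\varphi^2\,dx\le\int_{\mathbb{R}^N}|\nabla\varphi|^2\,dx$; here $f'(0)$ denotes the right derivative of $f$ at $0$ (which exists and is finite by convexity and monotonicity). *)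

theory Defs
  imports "HOL-Analysis.Analysis"
begin

definition partial_deriv :: "'n \<Rightarrow> (real ^ 'n \<Rightarrow> real) \<Rightarrow> real ^ 'n \<Rightarrow> real" where
  "partial_deriv i g x = frechet_derivative g (at x) (axis i 1)"

definition gradient :: "(real ^ 'n \<Rightarrow> real) \<Rightarrow> real ^ 'n \<Rightarrow> real ^ 'n" where
  "gradient g x = (\<chi> i. partial_deriv i g x)"

definition laplacian :: "(real ^ 'n \<Rightarrow> real) \<Rightarrow> real ^ 'n \<Rightarrow> real" where
  "laplacian g x = (\<Sum>i\<in>UNIV. partial_deriv i (partial_deriv i g) x)"

definition C1_space :: "(real ^ 'n \<Rightarrow> real) \<Rightarrow> bool" where
  "C1_space g \<longleftrightarrow>
     (\<forall>x. g differentiable (at x)) \<and> (\<forall>i. continuous_on UNIV (partial_deriv i g))"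

definition C2_space :: "(real ^ 'n \<Rightarrow> real) \<Rightarrow> bool" where
  "C2_space g \<longleftrightarrow> C1_space g \<and> (\<forall>i. C1_space (partial_deriv i g))"

definition C1_compact_support :: "(real ^ 'n \<Rightarrow> real) \<Rightarrow> bool" where
  "C1_compact_support g \<longleftrightarrow> C1_space g \<and> compact (closure {x. g x \<noteq> 0})"

definition C2_on_pos :: "(real \<Rightarrow> real) \<Rightarrow> bool" where
  "C2_on_pos f \<longleftrightarrow>
     f C1_differentiable_on {0<..} \<and> deriv f C1_differentiable_on {0<..}"

(* The nonlinearity f lives on [0,\<infinity>); its values at negative arguments are irrelevant.
   Taking the derivative within [0,\<infinity>) gives the ordinary derivative at s > 0 and the
   right derivative at s = 0. *)
definition deriv_half_line :: "(real \<Rightarrow> real) \<Rightarrow> real \<Rightarrow> real" where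
  "deriv_half_line f s = vector_derivative f (at s within {0..})"

definition q_fun :: "(real \<Rightarrow> real) \<Rightarrow> real \<Rightarrow> ereal" where
  "q_fun f s =
     (if f s * deriv (deriv f) s \<noteq> 0
      then ereal ((deriv f s)\<^sup>2 / (f s * deriv (deriv f) s)) else \<infinity>)"

(* The value at -\<infinity> is arbitrary: for convex f > 0 the function q_fun f is nonnegative
   on (0,\<infinity>), hence so is its limit at 0. *)
definition conjugate_exponent :: "ereal \<Rightarrow> ereal" where
  "conjugate_exponent q = (if q = 1 then \<infinity> else if q = \<infinity> then 1 else q / (q - 1))"

definition p_crit :: "nat \<Rightarrow> real" where
  "p_crit N =
     ((real N - 2)\<^sup>2 - 4 * real N + 8 * sqrt (real N - 1)) / ((real N - 2) * (real N - 10))"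

definition stable_solution :: "(real \<Rightarrow> real) \<Rightarrow> (real ^ 'n \<Rightarrow> real) \<Rightarrow> bool" where
  "stable_solution f u \<longleftrightarrow>
     (\<forall>\<phi>. C1_compact_support \<phi> \<longrightarrow>
        (LINT x|lborel. deriv_half_line f (u x) * (\<phi> x)\<^sup>2)
          \<le> (LINT x|lborel. (norm (gradient \<phi> x))\<^sup>2))"

end

theory Submission
  imports Defs
begin

text \<open>Write \<open>r = f f'' / f'^2 = 1 / q\<close>, so \<open>r \<rightarrow> \<rho> = 1 / q\<^sub>0\<close> at \<open>0\<close>. If \<open>f 0 > 0\<close> or
  \<open>\<rho> = 0\<close>, then \<open>f(u) \<ge> c u^\<theta>\<close> with \<open>\<theta>\<close> as close to \<open>1\<close> as we like, and testing the equation with a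
  cutoff function already forces \<open>u = 0\<close>. Otherwise \<open>0 < \<rho> \<le> 1\<close>, and stability is tested with
  \<open>g(u) \<zeta>\<close>, where \<open>g\<close> behaves like \<open>f^(1 + \<beta>)\<close> near \<open>0\<close>, \<open>\<beta> < sqrt \<rho>\<close>, and is a multiple of \<open>f\<close> away
  from \<open>0\<close>. With \<open>G\<close> the primitive of \<open>g'^2\<close>, integration by parts turns the stability inequality into
  \<open>\<integral> (f'(u) g(u)^2 - f(u) G(u)) \<zeta>^2 \<le> C \<integral> g(u)^2 (|\<nabla>\<zeta>|^2 + |\<Delta>(\<zeta>^2)|)\<close>.
  The bound \<open>\<beta>^2 < \<rho>\<close> makes the integrand on the left at least \<open>c (g(u)^2)^\<theta>\<close> with
  \<open>\<theta> = 1 + \<sigma> / (2 (1 + \<beta>))\<close> for any \<open>\<sigma> > \<rho>\<close>, and Young's inequality on balls of radius \<open>R \<rightarrow> \<infinity>\<close> gives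
  \<open>g(u) = 0\<close> as soon as \<open>N < 2 \<theta> / (\<theta> - 1) = 2 + 4 (1 + \<beta>) / \<sigma>\<close>. Letting \<open>\<beta> \<rightarrow> sqrt \<rho>\<close> and
  \<open>\<sigma> \<rightarrow> \<rho>\<close>, the condition becomes \<open>N < 2 + 4 q\<^sub>0 + 4 sqrt q\<^sub>0\<close>, which is the stated one.\<close>

section \<open>Integration by parts\<close>

lemma integrable_compact_support:
  fixes h :: "'a::euclidean_space \<Rightarrow> real"
  assumes "continuous_on UNIV h" and "\<And>x. norm x \<ge> R \<Longrightarrow> h x = 0"
  shows "integrable lborel h"
proof -
  have "integrable lborel (\<lambda>x. indicator (cball 0 R) x *\<^sub>R h x)"
    by (intro borel_integrable_compact continuous_on_subset[OF assms(1)]) auto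
  moreover have "(\<lambda>x. indicator (cball 0 R) x *\<^sub>R h x) = h"
    using assms(2) by (force simp: indicator_def)
  ultimately show ?thesis by simp
qed

lemma lborel_integral_translate:
  fixes h :: "'a::euclidean_space \<Rightarrow> real"
  assumes "integrable lborel h"
  shows "integrable lborel (\<lambda>x. h (x + a))"
    and "(LINT x|lborel. h (x + a)) = (LINT x|lborel. h x)"
proof -
  have eq: "lborel = distr lborel borel (\<lambda>x. x + a)"
    using lborel_distr_plus[of a] by (simp add: add.commute[of _ a])
  show "integrable lborel (\<lambda>x. h (x + a))"
    using assms eq integrable_distr[of "\<lambda>x. x + a" lborel borel h] by auto
  show "(LINT x|lborel. h (x + a)) = (LINT x|lborel. h x)"
    using assms eq integral_distr[of "\<lambda>x. x + a" lborel borel h] by auto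
qed

text \<open>Difference quotients along \<open>e\<close> integrate to 0 by translation invariance.
  The mean value theorem bounds them on a fixed ball, so dominated convergence carries this over to
  the derivative.\<close>

lemma integral_directional_derivative_eq_0:
  fixes v :: "'a::euclidean_space \<Rightarrow> real"
  assumes der: "\<And>x. (v has_derivative D x) (at x)"
    and cont: "continuous_on UNIV (\<lambda>x. D x e)"
    and supp: "\<And>x. norm x \<ge> R \<Longrightarrow> v x = 0"
  shows "(LINT x|lborel. D x e) = 0"
proof -
  have contv: "continuous_on UNIV v"
    using der by (meson continuous_at_imp_continuous_on has_derivative_continuous)
  \<comment> \<open>The steps have length at most \<open>norm e\<close>, so outside
    \<open>cball 0 R'\<close> both \<open>x\<close> and the shifted point lie where \<open>v\<close>
    vanishes. The ball for \<open>B\<close> is larger by another \<open>norm e\<close>, to contain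
    the intermediate points of the mean value theorem.\<close>
  define R' where "R' = \<bar>R\<bar> + norm e + 1"
  obtain B where B: "\<And>x. x \<in> cball 0 (R' + norm e) \<Longrightarrow> \<bar>D x e\<bar> \<le> B"
  proof -
    have "bounded ((\<lambda>x. D x e) ` cball 0 (R' + norm e))"
      by (intro compact_imp_bounded compact_continuous_image continuous_on_subset[OF cont]) auto
    then show ?thesis by (force simp: bounded_iff intro: that)
  qed
  define s where "s n x = (v (x + (1 / real (Suc n)) *\<^sub>R e) - v x) * real (Suc n)" for n x
  have intv: "integrable lborel v"
    using contv supp by (rule integrable_compact_support)
  have line: "((\<lambda>t. v (x + t *\<^sub>R e)) has_real_derivative D (x + t *\<^sub>R e) e) (at t)" for x t
  proof -
    have "((\<lambda>t. x + t *\<^sub>R e) has_derivative (\<lambda>h. h *\<^sub>R e)) (at t)"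
      by (auto intro!: derivative_eq_intros)
    from has_derivative_compose[OF this der]
    have "((\<lambda>t. v (x + t *\<^sub>R e)) has_derivative (\<lambda>h. D (x + t *\<^sub>R e) (h *\<^sub>R e))) (at t)" .
    moreover have "D (x + t *\<^sub>R e) (h *\<^sub>R e) = D (x + t *\<^sub>R e) e * h" for h
      using linear_cmul[OF has_derivative_linear[OF der]] by simp
    ultimately show ?thesis by (simp add: has_field_derivative_def)
  qed
  have lim: "(\<lambda>n. s n x) \<longlonglongrightarrow> D x e" for x
  proof -
    have "((\<lambda>h. (v (x + h *\<^sub>R e) - v x) / h) \<longlongrightarrow> D x e) (at 0)"
      using line[of x 0] by (simp add: DERIV_def)
    moreover have "filterlim (\<lambda>n. 1 / real (Suc n)) (at 0) sequentially"
      by (intro filterlim_atI LIMSEQ_Suc[OF lim_1_over_n]) auto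
    ultimately have "(\<lambda>n. (v (x + (1 / real (Suc n)) *\<^sub>R e) - v x) / (1 / real (Suc n)))
                      \<longlonglongrightarrow> D x e"
      by (rule filterlim_compose)
    then show ?thesis by (simp add: s_def)
  qed
  have bound: "norm (s n x) \<le> indicator (cball 0 R') x * B" for n x
  proof (cases "norm x \<le> R'")
    case True
    obtain z where z: "0 < z" "z < 1 / real (Suc n)"
      "v (x + (1 / real (Suc n)) *\<^sub>R e) - v (x + 0 *\<^sub>R e)
         = (1 / real (Suc n) - 0) * D (x + z *\<^sub>R e) e"
      using MVT2[of 0 "1 / real (Suc n)" "\<lambda>t. v (x + t *\<^sub>R e)" "\<lambda>t. D (x + t *\<^sub>R e) e"] line
      by auto
    have "1 / real (Suc n) \<le> 1" by simp
    then have "z \<le> 1" using z(2) by linarith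
    have "norm (x + z *\<^sub>R e) \<le> norm x + \<bar>z\<bar> * norm e"
      by (metis norm_triangle_ineq norm_scaleR)
    also have "\<dots> \<le> R' + 1 * norm e"
      using True \<open>z \<le> 1\<close> z(1) by (intro add_mono mult_right_mono) auto
    finally have "\<bar>D (x + z *\<^sub>R e) e\<bar> \<le> B" by (intro B) auto
    moreover have "s n x = D (x + z *\<^sub>R e) e" using z by (simp add: s_def)
    ultimately show ?thesis using True by simp
  next
    case False
    have *: "\<bar>R\<bar> \<le> norm (x + (1 / real (Suc n)) *\<^sub>R e)"
    proof -
      have "norm ((1 / real (Suc n)) *\<^sub>R e) \<le> 1 * norm e"
        unfolding norm_scaleR by (intro mult_right_mono) auto
      then show ?thesis
        using False norm_diff_ineq[of x "(1 / real (Suc n)) *\<^sub>R e"] by (simp add: R'_def)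
    qed
    have "R \<le> norm x"
      using False abs_ge_self[of R] norm_ge_zero[of e] unfolding R'_def
      by (meson add_increasing2 le_cases not_le order_trans zero_le_one)
    then have "v x = 0" by (rule supp)
    moreover have "v (x + (1 / real (Suc n)) *\<^sub>R e) = 0"
      by (rule supp[OF order_trans[OF abs_ge_self *]])
    ultimately show ?thesis using False by (simp add: s_def)
  qed
  have ints: "(LINT x|lborel. s n x) = 0" for n
    unfolding s_def
    using lborel_integral_translate[OF intv, of "(1 / real (Suc n)) *\<^sub>R e"] intv by simp
  have ms: "s n \<in> borel_measurable lborel" for n
    unfolding s_def
    using borel_measurable_integrable[OF lborel_integral_translate(1)[OF intv, of "(1 / real (Suc n)) *\<^sub>R e"]]
      borel_measurable_integrable[OF intv]
    by (intro borel_measurable_times borel_measurable_diff borel_measurable_const)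
  have mD: "(\<lambda>x. D x e) \<in> borel_measurable lborel"
    using borel_measurable_continuous_onI[OF cont] by simp
  have ib: "integrable lborel (\<lambda>x. indicator (cball 0 R') x * B)"
    using borel_integrable_compact[of "cball 0 R'" "\<lambda>_. B"] by simp
  have "(\<lambda>n. LINT x|lborel. s n x) \<longlonglongrightarrow> (LINT x|lborel. D x e)"
    using lim bound
    by (intro integral_dominated_convergence[where w="\<lambda>x. indicator (cball 0 R') x * B"] mD ms ib) auto
  then show ?thesis unfolding ints using LIMSEQ_unique tendsto_const by blast
qed

section \<open>Gradients of C1 functions\<close>

lemma partial_deriv_eq:
  assumes "(g has_derivative D) (at x)"
  shows "partial_deriv i g x = D (axis i 1)"
  unfolding partial_deriv_def using frechet_derivative_at[OF assms] by simp

lemma has_derivative_gradient: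
  assumes "g differentiable (at x)"
  shows "(g has_derivative (\<lambda>h. gradient g x \<bullet> h)) (at x)"
proof -
  obtain D where D: "(g has_derivative D) (at x)"
    using assms by (auto simp: differentiable_def)
  have lin: "linear D" by (rule has_derivative_linear[OF D])
  have "D h = gradient g x \<bullet> h" for h
  proof -
    have "D h = D (\<Sum>i\<in>UNIV. h $ i *\<^sub>R axis i 1)"
      using basis_expansion[of h] by (simp add: scalar_mult_eq_scaleR)
    also have "\<dots> = (\<Sum>i\<in>UNIV. h $ i * D (axis i 1))"
      by (simp add: linear_sum[OF lin] linear_cmul[OF lin])
    finally show ?thesis
      by (simp add: gradient_def inner_vec_def partial_deriv_eq[OF D] mult.commute)
  qed
  then have "D = (\<lambda>h. gradient g x \<bullet> h)" by (rule ext)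
  with D show ?thesis by simp
qed

lemma C1_spaceI:
  assumes der: "\<And>x. (g has_derivative (\<lambda>h. p x \<bullet> h)) (at x)"
    and cont: "continuous_on UNIV p"
  shows "C1_space g" and "gradient g = p"
proof -
  have *: "partial_deriv i g = (\<lambda>x. p x $ i)" for i
    by (rule ext) (simp add: partial_deriv_eq[OF der] inner_axis)
  show "C1_space g"
    unfolding C1_space_def * using der cont
    by (auto simp: differentiable_def intro!: continuous_intros)
  show "gradient g = p"
    by (rule ext) (simp add: gradient_def * vec_eq_iff)
qed

lemma C1_space_gradient:
  assumes "C1_space g"
  shows "(g has_derivative (\<lambda>h. gradient g x \<bullet> h)) (at x)"
    and "continuous_on UNIV (gradient g)"
proof -
  show "(g has_derivative (\<lambda>h. gradient g x \<bullet> h)) (at x)"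
    using assms by (intro has_derivative_gradient) (auto simp: C1_space_def)
  show "continuous_on UNIV (gradient g)"
    using assms unfolding gradient_def C1_space_def
    by (auto intro!: continuous_on_vec_lambda)
qed

lemma gradient_nth: "gradient g x $ i = partial_deriv i g x"
  by (simp add: gradient_def)

lemma laplacian_eq: "laplacian u x = (\<Sum>i\<in>UNIV. gradient (partial_deriv i u) x $ i)"
  by (simp add: laplacian_def gradient_nth)

lemma continuous_on_laplacian:
  assumes "C2_space u"
  shows "continuous_on UNIV (laplacian u)"
  unfolding laplacian_def using assms by (auto simp: C2_space_def C1_space_def intro!: continuous_intros)

lemma C1_space_continuous: "C1_space g \<Longrightarrow> continuous_on UNIV g"
  by (intro continuous_at_imp_continuous_on ballI has_derivative_continuous[OF C1_space_gradient(1)])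

lemma continuous_on_compose_nonneg:
  fixes u :: "'a::topological_space \<Rightarrow> real"
  assumes "continuous_on {0..} G" "continuous_on UNIV u" "\<And>x. u x \<ge> 0"
  shows "continuous_on UNIV (\<lambda>x. G (u x))"
  by (rule continuous_on_compose2[OF assms(1,2)]) (use assms(3) in auto)

section \<open>Divergence identities for compactly supported fields\<close>

lemma integral_divergence_eq_0:
  fixes V :: "'n::finite \<Rightarrow> real ^ 'n \<Rightarrow> real"
  assumes der: "\<And>i x. (V i has_derivative (\<lambda>h. W i x \<bullet> h)) (at x)"
    and cont: "\<And>i. continuous_on UNIV (W i)"
    and supp: "\<And>i x. norm x \<ge> R \<Longrightarrow> V i x = 0"
    and suppW: "\<And>i x. norm x \<ge> R \<Longrightarrow> W i x $ i = 0"
  shows "(LINT x|lborel. (\<Sum>i\<in>UNIV. W i x $ i)) = 0"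
proof -
  have c: "continuous_on UNIV (\<lambda>x. W i x $ i)" for i
    using cont by (intro continuous_intros)
  have "(LINT x|lborel. W i x \<bullet> axis i 1) = 0" for i
    by (rule integral_directional_derivative_eq_0[OF der _ supp]) (use c in \<open>simp_all add: inner_axis\<close>)
  then have 0: "(LINT x|lborel. W i x $ i) = 0" for i
    by (simp add: inner_axis)
  have "integrable lborel (\<lambda>x. W i x $ i)" for i
    using c suppW by (rule integrable_compact_support)
  then show ?thesis by (subst Bochner_Integration.integral_sum) (simp_all add: 0)
qed

text \<open>\<open>G\<close> may have only a one-sided derivative at 0. Since \<open>u\<close> never
  leaves the half line, the derivative of \<open>G\<close> within the range of \<open>u\<close> is
  enough, even at zeros of \<open>u\<close>.\<close>

lemma has_derivative_compose_nonneg: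
  fixes u :: "'a::real_inner \<Rightarrow> real"
  assumes "(u has_derivative (\<lambda>h. p \<bullet> h)) (at x)" and "\<And>x. u x \<ge> 0"
    and "\<And>s. s \<ge> 0 \<Longrightarrow> (G has_real_derivative G' s) (at s within {0..})"
  shows "((\<lambda>x. G (u x)) has_derivative (\<lambda>h. (G' (u x) *\<^sub>R p) \<bullet> h)) (at x)"
proof -
  have "(G has_real_derivative G' (u x)) (at (u x) within {0..})"
    by (intro assms)
  then have "(G has_derivative (*) (G' (u x))) (at (u x) within range u)"
    unfolding has_field_derivative_def by (rule has_derivative_subset) (use assms(2) in auto)
  from has_derivative_in_compose[OF assms(1) this] show ?thesis by simp
qed

text \<open>This integrates the divergence of G(u) \<psi> grad u. With G' = g'^2 it trades the
  Dirichlet term of the stability inequality for terms without |grad u|^2.\<close>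

lemma green_first:
  fixes u :: "real ^ 'n \<Rightarrow> real"
  assumes u: "C2_space u" "\<And>x. u x \<ge> 0"
    and G: "\<And>s. s \<ge> 0 \<Longrightarrow> (G has_real_derivative G' s) (at s within {0..})" "continuous_on {0..} G'"
    and psi: "\<And>x. (\<psi> has_derivative (\<lambda>h. p x \<bullet> h)) (at x)" "continuous_on UNIV p"
    and supp: "\<And>x. norm x \<ge> R \<Longrightarrow> \<psi> x = 0" "\<And>x. norm x \<ge> R \<Longrightarrow> p x = 0"
  shows "(LINT x|lborel. G' (u x) * (norm (gradient u x))\<^sup>2 * \<psi> x
           + G (u x) * (laplacian u x * \<psi> x + gradient u x \<bullet> p x)) = 0"
proof -
  have C1: "C1_space u" "C1_space (partial_deriv i u)" for i
    using u(1) by (auto simp: C2_space_def)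
  have contG: "continuous_on {0..} G"
    unfolding continuous_on_eq_continuous_within by (auto intro!: DERIV_continuous[OF G(1)])
  have contpsi: "continuous_on UNIV \<psi>"
    by (intro continuous_at_imp_continuous_on ballI has_derivative_continuous[OF psi(1)])
  have cpd: "continuous_on UNIV (partial_deriv i u)" for i
    using C1(2) by (rule C1_space_continuous)
  have cont: "continuous_on UNIV (\<lambda>x. G (u x))" "continuous_on UNIV (\<lambda>x. G' (u x))"
    using C1_space_continuous[OF C1(1)] u(2) contG G(2)
    by (auto intro: continuous_on_compose_nonneg)
  define V where "V i x = G (u x) * (\<psi> x * partial_deriv i u x)" for i x
  define W where "W i x = (\<psi> x * partial_deriv i u x) *\<^sub>R G' (u x) *\<^sub>R gradient u x
     + G (u x) *\<^sub>R (partial_deriv i u x *\<^sub>R p x + \<psi> x *\<^sub>R gradient (partial_deriv i u) x)" for i x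
  have "(LINT x|lborel. (\<Sum>i\<in>UNIV. W i x $ i)) = 0"
  proof (rule integral_divergence_eq_0[where V=V and R=R])
    show "(V i has_derivative (\<lambda>h. W i x \<bullet> h)) (at x)" for i x
      unfolding V_def W_def
      by (rule has_derivative_eq_rhs, rule has_derivative_mult,
          rule has_derivative_compose_nonneg[OF C1_space_gradient(1)[OF C1(1)] u(2) G(1)], assumption,
          rule has_derivative_mult[OF psi(1) C1_space_gradient(1)[OF C1(2)]])
        (auto simp: algebra_simps inner_add_left)
    show "continuous_on UNIV (W i)" for i
      unfolding W_def
      by (intro continuous_intros cont contpsi psi(2) C1_space_gradient(2) C1 cpd)
  qed (auto simp: V_def W_def supp)
  moreover have "(\<Sum>i\<in>UNIV. W i x $ i) = G' (u x) * (norm (gradient u x))\<^sup>2 * \<psi> x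
           + G (u x) * (laplacian u x * \<psi> x + gradient u x \<bullet> p x)" for x
    by (simp add: W_def laplacian_eq power2_norm_eq_inner inner_vec_def gradient_nth
        sum.distrib sum_distrib_left sum_distrib_right algebra_simps)
  ultimately show ?thesis by simp
qed

text \<open>The field is L(u) p, and \<open>q i\<close> is the gradient of component
  \<open>i\<close> of \<open>p\<close>, so the last sum is div p. With p a cutoff gradient this
  removes the remaining first derivatives of \<open>u\<close>.\<close>

lemma green_second:
  fixes u :: "real ^ 'n \<Rightarrow> real" and q :: "'n \<Rightarrow> real ^ 'n \<Rightarrow> real ^ 'n"
  assumes u: "C1_space u" "\<And>x. u x \<ge> 0"
    and L: "\<And>s. s \<ge> 0 \<Longrightarrow> (L has_real_derivative L' s) (at s within {0..})" "continuous_on {0..} L'"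
    and p: "\<And>i x. ((\<lambda>x. p x $ i) has_derivative (\<lambda>h. q i x \<bullet> h)) (at x)"
      "\<And>i. continuous_on UNIV (q i)"
    and supp: "\<And>x. norm x \<ge> R \<Longrightarrow> p x = 0" "\<And>x i. norm x \<ge> R \<Longrightarrow> q i x $ i = 0"
  shows "(LINT x|lborel. L' (u x) * (gradient u x \<bullet> p x)
           + L (u x) * (\<Sum>i\<in>UNIV. q i x $ i)) = 0"
proof -
  have contL: "continuous_on {0..} L"
    unfolding continuous_on_eq_continuous_within by (auto intro!: DERIV_continuous[OF L(1)])
  have contp: "continuous_on UNIV (\<lambda>x. p x $ i)" for i
    by (intro continuous_at_imp_continuous_on ballI has_derivative_continuous[OF p(1)])
  have cont: "continuous_on UNIV (\<lambda>x. L (u x))" "continuous_on UNIV (\<lambda>x. L' (u x))"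
    using C1_space_continuous[OF u(1)] u(2) contL L(2)
    by (auto intro: continuous_on_compose_nonneg)
  define V where "V i x = L (u x) * p x $ i" for i x
  define W where "W i x = p x $ i *\<^sub>R L' (u x) *\<^sub>R gradient u x + L (u x) *\<^sub>R q i x" for i x
  have "(LINT x|lborel. (\<Sum>i\<in>UNIV. W i x $ i)) = 0"
  proof (rule integral_divergence_eq_0[where V=V and R=R])
    show "(V i has_derivative (\<lambda>h. W i x \<bullet> h)) (at x)" for i x
      unfolding V_def W_def
      by (rule has_derivative_eq_rhs, rule has_derivative_mult,
          rule has_derivative_compose_nonneg[OF C1_space_gradient(1)[OF u(1)] u(2) L(1)], assumption,
          rule p(1))
        (auto simp: algebra_simps inner_add_left)
    show "continuous_on UNIV (W i)" for i
      unfolding W_def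
      by (intro continuous_intros cont contp p(2) C1_space_gradient(2) u(1))
  qed (auto simp: V_def W_def supp)
  moreover have "(\<Sum>i\<in>UNIV. W i x $ i) = L' (u x) * (gradient u x \<bullet> p x)
           + L (u x) * (\<Sum>i\<in>UNIV. q i x $ i)" for x
    by (simp add: W_def inner_vec_def sum.distrib sum_distrib_left algebra_simps)
  ultimately show ?thesis by simp
qed

section \<open>Cutoff functions and integral estimates\<close>

text \<open>A power of a truncated paraboloid: each derivative lowers \<open>n\<close> by one, so
  derivatives are controlled by lower powers of the same function.\<close>

definition cutoff :: "real \<Rightarrow> nat \<Rightarrow> 'a::real_inner \<Rightarrow> real" where
  "cutoff R n x = (max 0 (1 - (norm x)\<^sup>2 / R\<^sup>2)) ^ n"

definition cutoff_grad :: "real \<Rightarrow> nat \<Rightarrow> 'a::real_inner \<Rightarrow> 'a" where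
  "cutoff_grad R n x = (- (2 * real n / R\<^sup>2) * cutoff R (n - 1) x) *\<^sub>R x"

text \<open>The only delicate point is the corner t = 0, where the difference quotient is at most
  |h|^(n - 1), which tends to 0 because n >= 2.\<close>

lemma has_real_derivative_max_power:
  assumes "n \<ge> 2"
  shows "((\<lambda>t. (max 0 t) ^ n) has_real_derivative real n * (max 0 t) ^ (n - 1)) (at t)"
proof -
  consider "t > 0" | "t < 0" | "t = 0" by linarith
  then show ?thesis
  proof cases
    case 1
    have "((\<lambda>t. t ^ n) has_real_derivative real n * t ^ (n - 1)) (at t)"
      by (auto intro!: derivative_eq_intros)
    then have "((\<lambda>t. (max 0 t) ^ n) has_real_derivative real n * t ^ (n - 1)) (at t)"
      by (rule has_field_derivative_transform_within_open[where S="{0<..}"]) (use 1 in auto)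
    then show ?thesis using 1 by simp
  next
    case 2
    have "((\<lambda>t. 0) has_real_derivative 0) (at t)" by simp
    then have "((\<lambda>t. (max 0 t) ^ n) has_real_derivative 0) (at t)"
      by (rule has_field_derivative_transform_within_open[where S="{..<0}"]) (use 2 assms in auto)
    moreover have "0 < n - 1" using assms by simp
    ultimately show ?thesis using 2 by (simp add: zero_power del: One_nat_def)
  next
    case 3
    have "((\<lambda>h::real. (max 0 h) ^ n / h) \<longlongrightarrow> 0) (at 0)"
    proof (rule Lim_null_comparison)
      have "\<bar>(max 0 h) ^ n / h\<bar> \<le> \<bar>h\<bar> ^ (n - 1)" for h :: real
      proof -
        have "n = Suc (n - 1)" using assms by simp
        then have "(max 0 h) ^ n / h = (if h > 0 then h ^ (n - 1) else 0)"
          by (metis (no_types, opaque_lifting) div_0 less_eq_real_def max.absorb1 max.absorb2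
              mult.commute nonzero_mult_div_cancel_right not_less order_less_irrefl power_Suc power_eq_0_iff zero_less_Suc)
        then show ?thesis by simp
      qed
      then show "\<forall>\<^sub>F h in at 0. norm ((max 0 h) ^ n / h) \<le> \<bar>h\<bar> ^ (n - 1)" for h :: real
        by simp
      have "((\<lambda>h::real. \<bar>h\<bar> ^ (n - 1)) \<longlongrightarrow> \<bar>0\<bar> ^ (n - 1)) (at 0)"
        by (intro tendsto_intros)
      moreover have "\<bar>0::real\<bar> ^ (n - 1) = 0"
        using assms zero_power[of "n - 1"] by simp
      ultimately show "((\<lambda>h::real. \<bar>h\<bar> ^ (n - 1)) \<longlongrightarrow> 0) (at 0)"
        by (simp only:)
    qed
    then show ?thesis using assms 3 by (simp add: DERIV_def zero_power)
  qed
qed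

lemma has_derivative_cutoff:
  assumes "R > 0" "n \<ge> 2"
  shows "(cutoff R n has_derivative (\<lambda>h. cutoff_grad R n x \<bullet> h)) (at x)"
proof -
  have "((\<lambda>x. 1 - (x \<bullet> x) / R\<^sup>2) has_derivative (\<lambda>h. - (2 * (x \<bullet> h) / R\<^sup>2))) (at x)"
    by (rule has_derivative_eq_rhs, (rule derivative_intros)+)
       (use assms(1) in \<open>auto simp: inner_commute divide_simps\<close>)
  from has_derivative_compose[OF this has_real_derivative_max_power[OF assms(2), unfolded has_field_derivative_def]]
  show ?thesis
    unfolding cutoff_def[abs_def] cutoff_grad_def power2_norm_eq_inner
    by (rule has_derivative_eq_rhs) (use assms(1) in \<open>auto simp: algebra_simps cutoff_def power2_norm_eq_inner\<close>)
qed

lemma continuous_on_cutoff: "continuous_on A (cutoff R n)"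
  unfolding cutoff_def divide_inverse by (intro continuous_intros)

lemma continuous_on_cutoff_grad: "continuous_on A (cutoff_grad R n)"
  unfolding cutoff_grad_def by (intro continuous_intros continuous_on_cutoff)

lemma cutoff_eq_0: "R > 0 \<Longrightarrow> norm x \<ge> R \<Longrightarrow> n > 0 \<Longrightarrow> cutoff R n x = 0"
  using power_mono[of R "norm x" 2] by (simp add: cutoff_def)

lemma cutoff_nonneg: "cutoff R n x \<ge> 0"
  by (simp add: cutoff_def)

lemma cutoff_antimono: "m \<le> n \<Longrightarrow> cutoff R n x \<le> cutoff R m x"
  unfolding cutoff_def by (rule power_decreasing) auto

lemma cutoff_sq: "(cutoff R m x)\<^sup>2 = cutoff R (2 * m) x"
  by (simp add: cutoff_def power_mult[symmetric] mult.commute)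

text \<open>A factor \<open>norm x\<close> produced by differentiation is at most \<open>R\<close>
  wherever the cutoff lives. Against the 1/R^2 in front, each derivative thus costs only
  1/R.\<close>

lemma cutoff_norm_sq_le: 
  assumes "R > 0" "n > 0"
  shows "cutoff R n x * (norm x)\<^sup>2 \<le> cutoff R n x * R\<^sup>2"
proof (cases "norm x \<le> R")
  case True
  then show ?thesis by (intro mult_left_mono power_mono cutoff_nonneg) auto
next
  case False
  then show ?thesis using cutoff_eq_0[of R x n] assms by simp
qed

lemma norm_cutoff_grad_sq_le:
  assumes "R > 0" "m \<ge> 2"
  shows "(norm (cutoff_grad R m x))\<^sup>2 \<le> 4 * (real m)\<^sup>2 / R\<^sup>2 * cutoff R (2 * m - 2) x"
proof -
  have "(norm (cutoff_grad R m x))\<^sup>2 = 4 * (real m)\<^sup>2 / R^4 * (cutoff R (2 * (m - 1)) x * (norm x)\<^sup>2)"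
    by (simp add: cutoff_grad_def cutoff_sq[symmetric] power_mult_distrib power_divide)
  also have "\<dots> \<le> 4 * (real m)\<^sup>2 / R^4 * (cutoff R (2 * (m - 1)) x * R\<^sup>2)"
    using assms by (intro mult_left_mono cutoff_norm_sq_le) auto
  also have "\<dots> = 4 * (real m)\<^sup>2 / R\<^sup>2 * cutoff R (2 * m - 2) x"
    using assms by (simp add: power4_eq_xxxx power2_eq_square right_diff_distrib')
  finally show ?thesis .
qed

text \<open>Row \<open>i\<close> of the Hessian, written as the gradient of component
  \<open>i\<close> of \<open>cutoff_grad\<close>; for n >= 3 its diagonal entries sum to the
  Laplacian of the cutoff.\<close>

definition cutoff_hess :: "real \<Rightarrow> nat \<Rightarrow> 'n \<Rightarrow> real ^ 'n \<Rightarrow> real ^ 'n" where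
  "cutoff_hess R n i x =
     (- (2 * real n / R\<^sup>2)) *\<^sub>R (x $ i *\<^sub>R cutoff_grad R (n - 1) x + cutoff R (n - 1) x *\<^sub>R axis i 1)"

lemma has_derivative_cutoff_grad:
  assumes "R > 0" "n \<ge> 3"
  shows "((\<lambda>x. cutoff_grad R n x $ i) has_derivative (\<lambda>h. cutoff_hess R n i x \<bullet> h)) (at x)"
proof -
  have *: "(cutoff R (n - 1) has_derivative (\<lambda>h. cutoff_grad R (n - 1) x \<bullet> h)) (at x)"
    using assms by (intro has_derivative_cutoff) auto
  have "((\<lambda>x. x $ i) has_derivative (\<lambda>h. h $ i)) (at x)"
    by (intro bounded_linear_imp_has_derivative bounded_linear_vec_nth)
  from has_derivative_mult_right[OF has_derivative_mult[OF * this], of "- (2 * real n / R\<^sup>2)"]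
  show ?thesis unfolding cutoff_grad_def cutoff_hess_def
    by (simp add: algebra_simps inner_axis' cutoff_grad_def inner_add_left inner_diff_left)
qed

lemma continuous_on_cutoff_hess: "continuous_on A (cutoff_hess R n i)"
  unfolding cutoff_hess_def by (intro continuous_intros continuous_on_cutoff continuous_on_cutoff_grad)

text \<open>The trace of the Hessian has a nonnegative part containing |x|^2 and a nonpositive part
  containing the dimension; each is bounded separately.\<close>

lemma abs_cutoff_laplacian_le:
  fixes x :: "real ^ 'n"
  assumes "R > 0" "n \<ge> 3"
  shows "\<bar>\<Sum>i\<in>UNIV. cutoff_hess R n i x $ i\<bar>
           \<le> (4 * (real n)\<^sup>2 + 2 * real n * real CARD('n)) / R\<^sup>2 * cutoff R (n - 2) x"
proof -
  have n: "n - 1 - 1 = n - 2" by simp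
  have "(\<Sum>i\<in>UNIV. cutoff_hess R n i x $ i)
    = 4 * real n * real (n - 1) / R^4 * (cutoff R (n - 2) x * (norm x)\<^sup>2)
      - 2 * real n * real CARD('n) / R\<^sup>2 * cutoff R (n - 1) x"
  proof -
    have sums: "(\<Sum>i\<in>UNIV. a * (x $ i * x $ i) + b) = a * (norm x)\<^sup>2 + real CARD('n) * b" for a b
      by (simp add: sum.distrib sum_distrib_left[symmetric] power2_norm_eq_inner inner_vec_def)
    have alg: "(- (2 * real n / R\<^sup>2)) * (- (2 * k / R\<^sup>2) * a * b + N * c)
        = 4 * real n * k / R^4 * (a * b) - 2 * real n * N / R\<^sup>2 * c" for k a b c N :: real
      by (simp add: algebra_simps power4_eq_xxxx power2_eq_square)
    have "(\<Sum>i\<in>UNIV. cutoff_hess R n i x $ i)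
      = (- (2 * real n / R\<^sup>2)) * (\<Sum>i\<in>UNIV. - (2 * real (n - 1) / R\<^sup>2) * cutoff R (n - 2) x * (x $ i * x $ i)
          + cutoff R (n - 1) x)"
      unfolding sum_distrib_left
      by (intro sum.cong) (auto simp: cutoff_hess_def cutoff_grad_def n numeral_2_eq_2)
    also have "\<dots> = (- (2 * real n / R\<^sup>2)) * (- (2 * real (n - 1) / R\<^sup>2) * cutoff R (n - 2) x * (norm x)\<^sup>2
          + real CARD('n) * cutoff R (n - 1) x)"
      by (simp only: sums)
    also note alg
    finally show ?thesis .
  qed
  moreover have "0 \<le> 4 * real n * real (n - 1) / R^4 * (cutoff R (n - 2) x * (norm x)\<^sup>2)"
    by (intro mult_nonneg_nonneg cutoff_nonneg) auto
  moreover have "4 * real n * real (n - 1) / R^4 * (cutoff R (n - 2) x * (norm x)\<^sup>2)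
      \<le> 4 * (real n)\<^sup>2 / R^4 * (cutoff R (n - 2) x * R\<^sup>2)"
  proof (rule mult_mono)
    show "4 * real n * real (n - 1) / R^4 \<le> 4 * (real n)\<^sup>2 / R^4"
      by (intro divide_right_mono) (auto simp: power2_eq_square mult_left_mono)
    show "cutoff R (n - 2) x * (norm x)\<^sup>2 \<le> cutoff R (n - 2) x * R\<^sup>2"
      using assms by (intro cutoff_norm_sq_le) auto
  qed (auto intro!: mult_nonneg_nonneg cutoff_nonneg)
  moreover have "4 * (real n)\<^sup>2 / R^4 * (cutoff R (n - 2) x * R\<^sup>2) = 4 * (real n)\<^sup>2 / R\<^sup>2 * cutoff R (n - 2) x"
    using assms by (simp add: power4_eq_xxxx power2_eq_square)
  moreover have "0 \<le> 2 * real n * real CARD('n) / R\<^sup>2 * cutoff R (n - 1) x"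
    by (intro mult_nonneg_nonneg cutoff_nonneg) auto
  moreover have "2 * real n * real CARD('n) / R\<^sup>2 * cutoff R (n - 1) x
     \<le> 2 * real n * real CARD('n) / R\<^sup>2 * cutoff R (n - 2) x"
    by (intro mult_left_mono cutoff_antimono) auto
  moreover have "0 \<le> 4 * (real n)\<^sup>2 / R\<^sup>2 * cutoff R (n - 2) x"
    by (intro mult_nonneg_nonneg cutoff_nonneg) auto
  ultimately show ?thesis unfolding add_divide_distrib distrib_right by linarith
qed

section \<open>Weighted inequalities from the equation and from stability\<close>

lemma integral_weak_estimate:
  fixes u :: "real ^ 'n \<Rightarrow> real"
  assumes u: "C2_space u" "\<And>x. u x \<ge> 0" and eq: "\<And>x. - laplacian u x = f (u x)"
    and "R > 0" "n \<ge> 3"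
  shows "(LINT x|lborel. f (u x) * cutoff R n x)
    \<le> (4 * (real n)\<^sup>2 + 2 * real n * real CARD('n)) / R\<^sup>2 * (LINT x|lborel. u x * cutoff R (n - 2) x)"
proof -
  define lap where "lap x = (\<Sum>i\<in>UNIV. cutoff_hess R n i x $ i)" for x :: "real ^ 'n"
  define C where "C = (4 * (real n)\<^sup>2 + 2 * real n * real CARD('n)) / R\<^sup>2"
  have n: "n \<ge> 2" "n > 0" using assms(5) by auto
  have C1: "C1_space u" using u(1) by (simp add: C2_space_def)
  note cu = C1_space_continuous[OF C1]
  note cg = C1_space_gradient(2)[OF C1]
  have z: "norm x \<ge> R \<Longrightarrow> cutoff_grad R n x = 0" for x :: "real ^ 'n"
    using assms(4,5) by (simp add: cutoff_grad_def cutoff_eq_0)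
  have zh: "norm x \<ge> R \<Longrightarrow> cutoff_hess R n i x = 0" for x :: "real ^ 'n" and i
    using assms(4,5) by (simp add: cutoff_hess_def cutoff_grad_def cutoff_eq_0)
  have zl: "norm x \<ge> R \<Longrightarrow> lap x = 0" for x :: "real ^ 'n"
    by (simp add: lap_def zh)
  have clap: "continuous_on UNIV lap"
    unfolding lap_def by (intro continuous_intros continuous_on_cutoff_hess)
  \<comment> \<open>\<open>green_first\<close> with the constant G = 1, then
    \<open>green_second\<close> with L the identity: together they move both derivatives of the
    Laplacian onto the cutoff.\<close>
  have 1: "(LINT x|lborel. laplacian u x * cutoff R n x + gradient u x \<bullet> cutoff_grad R n x) = 0"
  proof -
    have "(LINT x|lborel. 0 * (norm (gradient u x))\<^sup>2 * cutoff R n x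
        + 1 * (laplacian u x * cutoff R n x + gradient u x \<bullet> cutoff_grad R n x)) = 0"
      by (rule green_first[where R=R,
            OF u _ _ has_derivative_cutoff[OF assms(4) n(1)] continuous_on_cutoff_grad])
        (use z n assms(4) in \<open>auto simp: cutoff_eq_0\<close>)
    then show ?thesis by simp
  qed
  have 2: "(LINT x|lborel. gradient u x \<bullet> cutoff_grad R n x + u x * lap x) = 0"
  proof -
    have "(LINT x|lborel. 1 * (gradient u x \<bullet> cutoff_grad R n x)
        + u x * (\<Sum>i\<in>UNIV. cutoff_hess R n i x $ i)) = 0"
      by (rule green_second[where R=R,
            OF C1 u(2) _ _ has_derivative_cutoff_grad[OF assms(4,5)] continuous_on_cutoff_hess])
        (use z zh in auto)
    then show ?thesis by (simp add: lap_def)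
  qed
  have i1: "integrable lborel (\<lambda>x. laplacian u x * cutoff R n x)"
    by (rule integrable_compact_support[where R=R])
      (use assms(4,5) in \<open>auto intro!: continuous_intros continuous_on_laplacian u continuous_on_cutoff simp: cutoff_eq_0\<close>)
  have i2: "integrable lborel (\<lambda>x. gradient u x \<bullet> cutoff_grad R n x)"
    by (rule integrable_compact_support[where R=R])
      (auto intro!: continuous_intros cg continuous_on_cutoff_grad simp: z)
  have i3: "integrable lborel (\<lambda>x. u x * lap x)"
    by (rule integrable_compact_support[where R=R])
      (auto intro!: continuous_intros cu clap simp: zl)
  have i4: "integrable lborel (\<lambda>x. u x * cutoff R (n - 2) x)"
    by (rule integrable_compact_support[where R=R])
      (use assms(4,5) in \<open>auto intro!: continuous_intros cu continuous_on_cutoff simp: cutoff_eq_0\<close>)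
  have "(LINT x|lborel. f (u x) * cutoff R n x) = - (LINT x|lborel. laplacian u x * cutoff R n x)"
    by (simp add: eq[symmetric])
  also have "\<dots> = - (LINT x|lborel. u x * lap x)"
    using 1 2 i1 i2 i3 by simp
  also have "\<dots> = (LINT x|lborel. - (u x * lap x))" by simp
  also have "\<dots> \<le> (LINT x|lborel. C * (u x * cutoff R (n - 2) x))"
  proof (rule integral_mono)
    show "integrable lborel (\<lambda>x. - (u x * lap x))" using i3 by simp
    show "integrable lborel (\<lambda>x. C * (u x * cutoff R (n - 2) x))" using i4 by simp
    fix x :: "real ^ 'n"
    have "\<bar>lap x\<bar> \<le> C * cutoff R (n - 2) x"
      unfolding lap_def C_def by (rule abs_cutoff_laplacian_le[OF assms(4,5)])
    then have "u x * (- lap x) \<le> u x * (C * cutoff R (n - 2) x)"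
      by (intro mult_left_mono u(2)) linarith
    then show "- (u x * lap x) \<le> C * (u x * cutoff R (n - 2) x)"
      by (simp add: algebra_simps)
  qed
  finally show ?thesis by (simp add: C_def)
qed

text \<open>Stability is tested with g(u) times a cutoff. Two integrations by parts reduce the
  squared gradient of this product to f(u) G(u) and terms of size g(u)^2 times derivatives of the
  cutoff. \<open>H\<close> stands for f' g^2, so that continuity up to 0 is asked of this product
  only.\<close>

lemma integral_stable_estimate:
  fixes u :: "real ^ 'n \<Rightarrow> real"
  assumes u: "C2_space u" "\<And>x. u x \<ge> 0" and eq: "\<And>x. - laplacian u x = f (u x)"
    and st: "stable_solution f u"
    and g: "\<And>s. s \<ge> 0 \<Longrightarrow> (g has_real_derivative g' s) (at s within {0..})" "continuous_on {0..} g'"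
    and G: "\<And>s. s \<ge> 0 \<Longrightarrow> (G has_real_derivative (g' s)\<^sup>2) (at s within {0..})"
    and L: "\<And>s. s \<ge> 0 \<Longrightarrow> (L has_real_derivative g s * g' s - G s) (at s within {0..})"
      "\<And>s. s \<ge> 0 \<Longrightarrow> \<bar>L s\<bar> \<le> (g s)\<^sup>2"
    and H: "\<And>s. s \<ge> 0 \<Longrightarrow> deriv_half_line f s * (g s)\<^sup>2 = H s" "continuous_on {0..} H"
    and f: "continuous_on {0..} f"
    and "R > 0" "m \<ge> 2"
  shows "(LINT x|lborel. (H (u x) - f (u x) * G (u x)) * cutoff R (2 * m) x)
    \<le> (20 * (real m)\<^sup>2 + 4 * real m * real CARD('n)) / R\<^sup>2 * (LINT x|lborel. (g (u x))\<^sup>2 * cutoff R (2 * m - 2) x)"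
proof -
  define n where "n = 2 * m"
  have n: "n \<ge> 3" "m > 0" "n > 0" "n \<ge> 2" using assms(14) by (auto simp: n_def)
  define lap where "lap x = (\<Sum>i\<in>UNIV. cutoff_hess R n i x $ i)" for x :: "real ^ 'n"
  define \<phi> where "\<phi> x = g (u x) * cutoff R m x" for x
  define p where "p x = cutoff R m x *\<^sub>R g' (u x) *\<^sub>R gradient u x + g (u x) *\<^sub>R cutoff_grad R m x" for x
  have C1: "C1_space u" using u(1) by (simp add: C2_space_def)
  note cu = C1_space_continuous[OF C1]
  note cgrad = C1_space_gradient(2)[OF C1]
  have cg: "continuous_on {0..} g"
    unfolding continuous_on_eq_continuous_within by (auto intro!: DERIV_continuous[OF g(1)])
  have cG: "continuous_on {0..} G"
    unfolding continuous_on_eq_continuous_within by (auto intro!: DERIV_continuous[OF G])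
  have cL: "continuous_on {0..} L"
    unfolding continuous_on_eq_continuous_within by (auto intro!: DERIV_continuous[OF L(1)])
  note comp = continuous_on_compose_nonneg[OF _ cu u(2)]
  note cont = comp[OF cg] comp[OF cG] comp[OF cL] comp[OF g(2)] comp[OF H(2)] comp[OF f]
  have z: "norm x \<ge> R \<Longrightarrow> cutoff_grad R n x = 0" for x :: "real ^ 'n"
    using assms(13) n by (simp add: cutoff_grad_def cutoff_eq_0)
  have zm: "norm x \<ge> R \<Longrightarrow> cutoff_grad R m x = 0" for x :: "real ^ 'n"
    using assms(13,14) by (simp add: cutoff_grad_def cutoff_eq_0)
  have zh: "norm x \<ge> R \<Longrightarrow> cutoff_hess R n i x = 0" for x :: "real ^ 'n" and i
    using assms(13) n by (simp add: cutoff_hess_def cutoff_grad_def cutoff_eq_0)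
  have zl: "norm x \<ge> R \<Longrightarrow> lap x = 0" for x :: "real ^ 'n"
    by (simp add: lap_def zh)
  have clap: "continuous_on UNIV lap"
    unfolding lap_def by (intro continuous_intros continuous_on_cutoff_hess)
  have cp: "continuous_on UNIV p"
    unfolding p_def by (intro continuous_intros continuous_on_cutoff continuous_on_cutoff_grad cont cgrad)
  have dphi: "(\<phi> has_derivative (\<lambda>h. p x \<bullet> h)) (at x)" for x
    unfolding \<phi>_def p_def
    by (rule has_derivative_eq_rhs, rule has_derivative_mult,
        rule has_derivative_compose_nonneg[OF C1_space_gradient(1)[OF C1] u(2) g(1)], assumption,
        rule has_derivative_cutoff)
      (use assms(13,14) in \<open>auto simp: algebra_simps inner_add_left\<close>)
  have "C1_compact_support \<phi>"
    unfolding C1_compact_support_def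
  proof
    show "C1_space \<phi>" using dphi cp by (rule C1_spaceI)
    have "{x. \<phi> x \<noteq> 0} \<subseteq> cball 0 R"
      using cutoff_eq_0[OF assms(13), of _ m] n by (force simp: \<phi>_def)
    then have "bounded {x. \<phi> x \<noteq> 0}" using bounded_subset bounded_cball by blast
    then show "compact (closure {x. \<phi> x \<noteq> 0})" by (simp add: compact_closure)
  qed
  then have "(LINT x|lborel. deriv_half_line f (u x) * (\<phi> x)\<^sup>2) \<le> (LINT x|lborel. (norm (gradient \<phi> x))\<^sup>2)"
    using st by (simp add: stable_solution_def)
  moreover have "deriv_half_line f (u x) * (\<phi> x)\<^sup>2 = H (u x) * cutoff R n x" for x
    unfolding \<phi>_def power_mult_distrib cutoff_sq n_def
    using H(1)[OF u(2), of x] by (simp add: mult.assoc[symmetric])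
  moreover have "gradient \<phi> = p" using dphi cp by (rule C1_spaceI)
  ultimately have stab: "(LINT x|lborel. H (u x) * cutoff R n x) \<le> (LINT x|lborel. (norm (p x))\<^sup>2)"
    by simp
  \<comment> \<open>\<open>A\<close> and \<open>B\<close> are the integrands of the two Green
    identities and integrate to 0. They absorb every term of |p|^2 that contains grad u: since the
    Laplacian of u is -f(u), |p|^2 = A + B + X + Y with X and Y free of grad u.\<close>
  define A where "A x = (g' (u x))\<^sup>2 * (norm (gradient u x))\<^sup>2 * cutoff R n x
           + G (u x) * (laplacian u x * cutoff R n x + gradient u x \<bullet> cutoff_grad R n x)" for x
  define B where "B x = (g (u x) * g' (u x) - G (u x)) * (gradient u x \<bullet> cutoff_grad R n x) + L (u x) * lap x" for x
  have A: "(LINT x|lborel. A x) = 0"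
    unfolding A_def
    by (rule green_first[OF u G _ has_derivative_cutoff[OF assms(13) n(4)] continuous_on_cutoff_grad, where R=R])
      (use n assms(13) z in \<open>auto intro!: continuous_intros g(2) simp: cutoff_eq_0\<close>)
  have B: "(LINT x|lborel. B x) = 0"
    unfolding B_def lap_def
    by (rule green_second[OF C1 u(2) L(1) _ has_derivative_cutoff_grad[OF assms(13) n(1)] continuous_on_cutoff_hess, where R=R])
      (use z zh in \<open>auto intro!: continuous_intros g(2) cg cG\<close>)
  define X where "X x = f (u x) * G (u x) * cutoff R n x" for x
  define Y where "Y x = (g (u x))\<^sup>2 * (norm (cutoff_grad R m x))\<^sup>2 - L (u x) * lap x" for x
  have cross: "cutoff_grad R n x = (2 * cutoff R m x) *\<^sub>R cutoff_grad R m x" for x :: "real ^ 'n"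
  proof -
    have "cutoff R (n - 1) x = cutoff R m x * cutoff R (m - 1) x"
      using n by (simp add: cutoff_def power_add[symmetric] n_def mult_2)
    then show ?thesis by (simp add: cutoff_grad_def n_def)
  qed
  have psq: "(norm (p x))\<^sup>2 = A x + B x + X x + Y x" for x
  proof -
    have "(norm (p x))\<^sup>2 = (g' (u x))\<^sup>2 * (norm (gradient u x))\<^sup>2 * (cutoff R m x)\<^sup>2
       + g (u x) * g' (u x) * (gradient u x \<bullet> cutoff_grad R n x)
       + (g (u x))\<^sup>2 * (norm (cutoff_grad R m x))\<^sup>2"
      unfolding cross power2_norm_eq_inner p_def
      by (simp add: inner_add_left inner_add_right inner_commute power2_eq_square algebra_simps)
    then show ?thesis
      unfolding A_def B_def X_def Y_def cutoff_sq n_def[symmetric] eq[symmetric]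
      by (simp add: algebra_simps)
  qed
  have iA: "integrable lborel A" unfolding A_def
    by (rule integrable_compact_support[where R=R])
      (use n assms(13) in \<open>auto intro!: continuous_intros cont cgrad continuous_on_laplacian u continuous_on_cutoff continuous_on_cutoff_grad simp: cutoff_eq_0 z\<close>)
  have iB: "integrable lborel B" unfolding B_def
    by (rule integrable_compact_support[where R=R])
      (use n assms(13) in \<open>auto intro!: continuous_intros cont cgrad clap continuous_on_cutoff continuous_on_cutoff_grad simp: cutoff_eq_0 z zl\<close>)
  have iX: "integrable lborel X" unfolding X_def
    by (rule integrable_compact_support[where R=R])
      (use n assms(13) in \<open>auto intro!: continuous_intros cont continuous_on_cutoff simp: cutoff_eq_0\<close>)
  have iY: "integrable lborel Y" unfolding Y_def
    by (rule integrable_compact_support[where R=R])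
      (use n assms(13) in \<open>auto intro!: continuous_intros cont clap continuous_on_cutoff_grad simp: zm zl\<close>)
  have iH: "integrable lborel (\<lambda>x. H (u x) * cutoff R n x)"
    by (rule integrable_compact_support[where R=R])
      (use n assms(13) in \<open>auto intro!: continuous_intros cont continuous_on_cutoff simp: cutoff_eq_0\<close>)
  have iw: "integrable lborel (\<lambda>x. (g (u x))\<^sup>2 * cutoff R (n - 2) x)"
    by (rule integrable_compact_support[where R=R])
      (use n assms(13) in \<open>auto intro!: continuous_intros cont continuous_on_cutoff simp: cutoff_eq_0\<close>)
  define C where "C = (20 * (real m)\<^sup>2 + 4 * real m * real CARD('n)) / R\<^sup>2"
  have "(LINT x|lborel. (H (u x) - f (u x) * G (u x)) * cutoff R n x)
      = (LINT x|lborel. H (u x) * cutoff R n x) - (LINT x|lborel. X x)"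
  proof -
    have X: "X = (\<lambda>x. f (u x) * G (u x) * cutoff R n x)" by (simp add: fun_eq_iff X_def)
    show ?thesis
      using Bochner_Integration.integral_diff[OF iH iX] unfolding X by (simp add: left_diff_distrib)
  qed
  also have "\<dots> \<le> (LINT x|lborel. (norm (p x))\<^sup>2) - (LINT x|lborel. X x)"
    using stab by simp
  also have "\<dots> = (LINT x|lborel. Y x)"
    unfolding psq using iA iB iX iY A B by simp
  also have "\<dots> \<le> (LINT x|lborel. C * ((g (u x))\<^sup>2 * cutoff R (n - 2) x))"
  proof (rule integral_mono)
    show "integrable lborel (\<lambda>x. C * ((g (u x))\<^sup>2 * cutoff R (n - 2) x))" using iw by simp
    fix x :: "real ^ 'n"
    define t where "t = cutoff R (n - 2) x / R\<^sup>2"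
    have 1: "(norm (cutoff_grad R m x))\<^sup>2 \<le> 4 * (real m)\<^sup>2 * t"
      using norm_cutoff_grad_sq_le[OF assms(13,14), of x] by (simp add: n_def t_def)
    have 2: "\<bar>lap x\<bar> \<le> (4 * (real n)\<^sup>2 + 2 * real n * real CARD('n)) * t"
      using abs_cutoff_laplacian_le[OF assms(13) n(1), of x] by (simp add: lap_def t_def)
    have 3: "\<bar>L (u x) * lap x\<bar> \<le> (g (u x))\<^sup>2 * ((4 * (real n)\<^sup>2 + 2 * real n * real CARD('n)) * t)"
      unfolding abs_mult by (intro mult_mono 2 L(2) u(2)) auto
    have 4: "(g (u x))\<^sup>2 * (norm (cutoff_grad R m x))\<^sup>2 \<le> (g (u x))\<^sup>2 * (4 * (real m)\<^sup>2 * t)"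
      by (intro mult_left_mono 1) auto
    \<comment> \<open>With n = 2 m the constants add up to 4 m^2 + 4 (2 m)^2 = 20 m^2 and 2 (2 m) N
      = 4 m N, where N is the dimension.\<close>
    have "Y x \<le> (g (u x))\<^sup>2 * (4 * (real m)\<^sup>2 * t) + (g (u x))\<^sup>2 * ((4 * (real n)\<^sup>2 + 2 * real n * real CARD('n)) * t)"
      unfolding Y_def using 3 4 by linarith
    also have "\<dots> = C * ((g (u x))\<^sup>2 * cutoff R (n - 2) x)"
      by (simp add: n_def C_def t_def power_mult_distrib add_divide_distrib algebra_simps)
    finally show "Y x \<le> C * ((g (u x))\<^sup>2 * cutoff R (n - 2) x)" .
  qed (rule iY)
  finally show ?thesis by (simp add: C_def n_def)
qed

section \<open>From the weighted inequality to vanishing\<close>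

lemma young_truncated:
  fixes b c w e \<theta> :: real and k l :: nat
  assumes "b \<ge> 0" "c > 0" "w \<ge> 0" "0 \<le> e" "e \<le> 1" "\<theta> > 1" "l > 0" "real k \<le> real l * \<theta>"
  shows "b * (w * e ^ l) \<le> c * (w powr \<theta> * e ^ k) + b * (b / c) powr (1 / (\<theta> - 1))"
proof -
  define A where "A = w * e ^ l"
  have "A \<ge> 0" using assms by (simp add: A_def)
  \<comment> \<open>Since e lies in [0, 1] and k <= l \<theta>, the weight e^(l \<theta>) is at most
    e^k.\<close>
  have 1: "A powr \<theta> \<le> w powr \<theta> * e ^ k"
  proof (cases "e = 0")
    case True
    then show ?thesis using assms by (simp add: A_def zero_power)
  next
    case False
    then have "e > 0" using assms by simp
    have "A powr \<theta> = w powr \<theta> * (e powr (real l * \<theta>))"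
      using \<open>e > 0\<close> assms by (simp add: A_def powr_mult powr_realpow[symmetric] powr_powr)
    also have "\<dots> \<le> w powr \<theta> * e powr (real k)"
      using \<open>e > 0\<close> assms by (intro mult_left_mono powr_mono') auto
    finally show ?thesis using \<open>e > 0\<close> by (simp add: powr_realpow)
  qed
  \<comment> \<open>Either A is so large that c A^\<theta> dominates b A, or A is at most (b / c)^(1
    / (\<theta> - 1)) and the constant term dominates.\<close>
  have "b * A \<le> c * A powr \<theta> + b * (b / c) powr (1 / (\<theta> - 1))"
  proof (cases "b \<le> c * A powr (\<theta> - 1)")
    case True
    then have "b * A \<le> c * A powr (\<theta> - 1) * A"
      using \<open>A \<ge> 0\<close> by (intro mult_right_mono) auto
    also have "\<dots> = c * A powr \<theta>"
      using \<open>A \<ge> 0\<close> powr_add[of A "\<theta> - 1" 1] by (cases "A = 0") auto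
    finally show ?thesis using assms by (simp add: add_increasing2)
  next
    case False
    then have "A powr (\<theta> - 1) \<le> b / c" using assms by (simp add: field_simps)
    then have "(A powr (\<theta> - 1)) powr (1 / (\<theta> - 1)) \<le> (b / c) powr (1 / (\<theta> - 1))"
      using assms by (intro powr_mono2) auto
    then have "A \<le> (b / c) powr (1 / (\<theta> - 1))"
      using assms \<open>A \<ge> 0\<close> by (simp add: powr_powr)
    then have "b * A \<le> b * (b / c) powr (1 / (\<theta> - 1))"
      using assms by (intro mult_left_mono) auto
    then show ?thesis using assms by (simp add: add_increasing)
  qed
  also have "\<dots> \<le> c * (w powr \<theta> * e ^ k) + b * (b / c) powr (1 / (\<theta> - 1))"
    using 1 assms by simp
  finally show ?thesis by (simp add: A_def)
qed

text \<open>Young's inequality spends half of the left side and leaves a constant of order R^(-2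
  \<theta> / (\<theta> - 1)) on a ball of volume of order R^d. By the bound on the dimension the
  product tends to 0, while the left side stays bounded below if w is positive somewhere.\<close>

lemma vanishing_of_cutoff_estimate:
  fixes w :: "'a::euclidean_space \<Rightarrow> real"
  assumes cont: "continuous_on UNIV w" and nonneg: "\<And>x. w x \<ge> 0"
    and "\<theta> > 1" "c > 0" "C > 0" "l > 0" "k > 0" "real k \<le> real l * \<theta>"
    and dim: "real DIM('a) < 2 * \<theta> / (\<theta> - 1)"
    and est: "\<And>R. R \<ge> 1 \<Longrightarrow> c * (LINT x|lborel. w x powr \<theta> * cutoff R k x)
      \<le> C / R\<^sup>2 * (LINT x|lborel. w x * cutoff R l x)"
  shows "w x\<^sub>0 = 0"
proof (rule ccontr)
  assume "w x\<^sub>0 \<noteq> 0"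
  then have "w x\<^sub>0 > 0" using nonneg[of x\<^sub>0] by simp
  define p where "p = 1 / (\<theta> - 1)"
  define d where "d = real DIM('a)"
  define \<kappa> where "\<kappa> = C * (2 * C / c) powr p"
  define V where "V = unit_ball_vol d"
  have upper: "(LINT x|lborel. w x powr \<theta> * cutoff R k x) \<le> 2 / c * \<kappa> * V * R powr (d - 2 * \<theta> / (\<theta> - 1))"
    if "R \<ge> 1" for R
  proof -
    define b where "b = C / R\<^sup>2"
    have cw: "continuous_on UNIV (\<lambda>x. w x powr \<theta>)"
      using cont nonneg assms(3) by (intro continuous_on_powr' continuous_intros) auto
    have i1: "integrable lborel (\<lambda>x. w x powr \<theta> * cutoff R k x)"
      by (rule integrable_compact_support[where R=R])
        (use that assms in \<open>auto intro!: continuous_intros cw continuous_on_cutoff simp: cutoff_eq_0\<close>)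
    have i2: "integrable lborel (\<lambda>x. w x * cutoff R l x)"
      by (rule integrable_compact_support[where R=R])
        (use that assms in \<open>auto intro!: continuous_intros cont continuous_on_cutoff simp: cutoff_eq_0\<close>)
    have i3: "integrable lborel (indicator (cball (0::'a) R) :: 'a \<Rightarrow> real)"
      using borel_integrable_compact[of "cball (0::'a) R" "\<lambda>_. 1::real"] by simp
    \<comment> \<open>Young's inequality is used with c / 2 in place of c, so that half of the
      integral on the left survives the absorption.\<close>
    define K where "K = b * (b / (c / 2)) powr p"
    have bb: "b \<ge> 0" using assms by (simp add: b_def)
    have "K \<ge> 0" using bb by (simp add: K_def)
    have "c * (LINT x|lborel. w x powr \<theta> * cutoff R k x) \<le> b * (LINT x|lborel. w x * cutoff R l x)"
      using est[OF that] by (simp add: b_def)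
    also have "\<dots> = (LINT x|lborel. b * (w x * cutoff R l x))" by simp
    also have "\<dots> \<le> (LINT x|lborel. c / 2 * (w x powr \<theta> * cutoff R k x) + K * indicator (cball 0 R) x)"
    proof (rule integral_mono)
      fix x :: 'a
      show "b * (w x * cutoff R l x) \<le> c / 2 * (w x powr \<theta> * cutoff R k x) + K * indicator (cball 0 R) x"
      proof (cases "norm x \<le> R")
        case True
        have "b * (w x * cutoff R l x) \<le> c / 2 * (w x powr \<theta> * cutoff R k x) + K"
          unfolding cutoff_def K_def p_def
          by (rule young_truncated) (use assms bb in auto)
        then show ?thesis using True by simp
      next
        case False
        then show ?thesis using assms that \<open>K \<ge> 0\<close> by (simp add: cutoff_eq_0)
      qed
    qed (use i1 i2 i3 in auto)
    also have "\<dots> = c / 2 * (LINT x|lborel. w x powr \<theta> * cutoff R k x) + K * measure lborel (cball (0::'a) R)"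
      using i1 i3 by (simp add: measure_def)
    finally have "(LINT x|lborel. w x powr \<theta> * cutoff R k x) \<le> 2 / c * (K * measure lborel (cball (0::'a) R))"
      using assms(4) by (simp add: field_simps)
    also have "measure lborel (cball (0::'a) R) = V * R powr d"
      using that by (simp add: content_cball V_def d_def powr_realpow)
    also have "K = \<kappa> * R powr (- 2 * \<theta> / (\<theta> - 1))"
    proof -
      have R: "1 / R\<^sup>2 = R powr (- 2)"
        using that by (simp add: powr_minus powr_numeral inverse_eq_divide)
      have b: "b / (c / 2) = (2 * C / c) * R powr (-2)"
        unfolding R[symmetric] b_def by (simp add: field_simps)
      have "(b / (c / 2)) powr p = (2 * C / c) powr p * R powr (- 2 * p)"
        unfolding b using assms(4,5) that by (subst powr_mult) (auto simp: powr_powr)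
      then have "K = \<kappa> * (R powr (- 2) * R powr (- 2 * p))"
        unfolding K_def \<kappa>_def b_def R[symmetric] by simp
      also have "R powr (- 2) * R powr (- 2 * p) = R powr (- 2 + - 2 * p)"
        by (simp only: powr_add)
      also have "- 2 + - 2 * p = - 2 * \<theta> / (\<theta> - 1)"
        using assms(3) by (simp add: p_def field_simps)
      finally show ?thesis .
    qed
    also have "2 / c * (\<kappa> * R powr (- 2 * \<theta> / (\<theta> - 1)) * (V * R powr d))
      = 2 / c * \<kappa> * V * (R powr d * R powr (- 2 * \<theta> / (\<theta> - 1)))" by simp
    also have "R powr d * R powr (- 2 * \<theta> / (\<theta> - 1)) = R powr (d - 2 * \<theta> / (\<theta> - 1))"
      by (simp add: powr_add[symmetric])
    finally show ?thesis .
  qed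
  obtain \<delta> where \<delta>: "\<delta> > 0" "\<And>x. x \<in> cball x\<^sub>0 \<delta> \<Longrightarrow> w x \<ge> w x\<^sub>0 / 2"
  proof -
    have "isCont w x\<^sub>0" using cont by (simp add: continuous_on_eq_continuous_at)
    then have "\<forall>\<^sub>F x in at x\<^sub>0. w x > w x\<^sub>0 / 2"
      unfolding isCont_def using \<open>w x\<^sub>0 > 0\<close> by (intro order_tendstoD) auto
    then obtain e where e: "e > 0" "\<And>x. x \<noteq> x\<^sub>0 \<Longrightarrow> dist x x\<^sub>0 < e \<Longrightarrow> w x > w x\<^sub>0 / 2"
      by (auto simp: eventually_at)
    have "w x \<ge> w x\<^sub>0 / 2" if "x \<in> cball x\<^sub>0 (e / 2)" for x
      using e(1) e(2)[of x] that \<open>w x\<^sub>0 > 0\<close> by (cases "x = x\<^sub>0") (auto simp: dist_commute)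
    then show ?thesis using e(1) by (intro that[of "e / 2"]) auto
  qed
  \<comment> \<open>Once R is at least 2 (\<open>norm x\<^sub>0\<close> + \<delta>), the ball around
    \<open>x\<^sub>0\<close> lies in the ball of radius R / 2 about the origin, where the base of
    the cutoff is at least 1 - 1/4 = 3/4.\<close>
  define \<epsilon> where "\<epsilon> = (w x\<^sub>0 / 2) powr \<theta> * (3 / 4) ^ k * measure lborel (cball x\<^sub>0 \<delta>)"
  have "\<epsilon> > 0" using \<delta>(1) \<open>w x\<^sub>0 > 0\<close> by (simp add: \<epsilon>_def content_cball_pos)
  have lower: "\<epsilon> \<le> (LINT x|lborel. w x powr \<theta> * cutoff R k x)"
    if R: "R \<ge> 1" "R \<ge> 2 * (norm x\<^sub>0 + \<delta>)" for R
  proof -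
    have cw: "continuous_on UNIV (\<lambda>x. w x powr \<theta>)"
      using cont nonneg assms(3) by (intro continuous_on_powr' continuous_intros) auto
    have i1: "integrable lborel (\<lambda>x. w x powr \<theta> * cutoff R k x)"
      by (rule integrable_compact_support[where R=R])
        (use R assms in \<open>auto intro!: continuous_intros cw continuous_on_cutoff simp: cutoff_eq_0\<close>)
    have i3: "integrable lborel (indicator (cball x\<^sub>0 \<delta>) :: 'a \<Rightarrow> real)"
      using borel_integrable_compact[of "cball x\<^sub>0 \<delta>" "\<lambda>_. 1::real"] by simp
    have "\<epsilon> = (LINT x|lborel. (w x\<^sub>0 / 2) powr \<theta> * (3 / 4) ^ k * indicator (cball x\<^sub>0 \<delta>) x)"
      using i3 by (simp add: \<epsilon>_def measure_def)
    also have "\<dots> \<le> (LINT x|lborel. w x powr \<theta> * cutoff R k x)"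
    proof (rule integral_mono)
      fix x
      show "(w x\<^sub>0 / 2) powr \<theta> * (3 / 4) ^ k * indicator (cball x\<^sub>0 \<delta>) x \<le> w x powr \<theta> * cutoff R k x"
      proof (cases "x \<in> cball x\<^sub>0 \<delta>")
        case True
        have "norm x \<le> norm x\<^sub>0 + \<delta>"
          using True norm_triangle_sub[of x x\<^sub>0] by (simp add: dist_norm norm_minus_commute)
        then have "2 * norm x \<le> 2 * (norm x\<^sub>0 + \<delta>)" by (intro mult_left_mono) auto
        also note R(2)
        finally have "norm x \<le> R / 2" by simp
        then have "(norm x)\<^sup>2 \<le> (R / 2)\<^sup>2" by (intro power_mono) auto
        then have "(norm x)\<^sup>2 / R\<^sup>2 \<le> 1 / 4" using R by (simp add: field_simps power_divide)
        then have "3 / 4 \<le> max 0 (1 - (norm x)\<^sup>2 / R\<^sup>2)" by linarith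
        then have "(3 / 4) ^ k \<le> cutoff R k x"
          unfolding cutoff_def by (rule power_mono) simp
        moreover have "(w x\<^sub>0 / 2) powr \<theta> \<le> w x powr \<theta>"
          using \<delta>(2)[OF True] \<open>w x\<^sub>0 > 0\<close> assms(3) by (intro powr_mono2) auto
        ultimately show ?thesis using True by (auto intro!: mult_mono)
      qed (auto simp: cutoff_nonneg)
    qed (use i1 i3 in auto)
    finally show ?thesis .
  qed
  have "((\<lambda>R. 2 / c * \<kappa> * V * R powr (d - 2 * \<theta> / (\<theta> - 1))) \<longlongrightarrow> 2 / c * \<kappa> * V * 0) at_top"
    by (intro tendsto_mult tendsto_const tendsto_neg_powr filterlim_ident) (use dim in \<open>simp add: d_def\<close>)
  then have "\<forall>\<^sub>F R in at_top. 2 / c * \<kappa> * V * R powr (d - 2 * \<theta> / (\<theta> - 1)) < \<epsilon>"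
    using \<open>\<epsilon> > 0\<close> by (intro order_tendstoD) auto
  moreover have "\<forall>\<^sub>F R::real in at_top. R \<ge> 1" by (rule eventually_ge_at_top)
  moreover have "\<forall>\<^sub>F R::real in at_top. R \<ge> 2 * (norm x\<^sub>0 + \<delta>)" by (rule eventually_ge_at_top)
  ultimately have "\<forall>\<^sub>F R::real in at_top. False"
  proof eventually_elim
    case (elim R)
    then show ?case using upper[of R] lower[of R] by linarith
  qed
  then show False by simp
qed

section \<open>The nonlinearity near zero\<close>

lemma has_real_derivative_integral_nonneg:
  fixes h :: "real \<Rightarrow> real"
  assumes "continuous_on {0..} h" "s \<ge> 0"
  shows "((\<lambda>x. integral {0..x} h) has_real_derivative h s) (at s within {0..})"
proof -
  have "((\<lambda>x. integral {0..x} h) has_real_derivative h s) (at s within {0..s + 1})"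
    by (rule integral_has_real_derivative) (use assms in \<open>auto intro: continuous_on_subset\<close>)
  moreover have "at s within {0..s + 1} = at s within {0..}"
    by (rule at_within_nhd[where S="{..<s + 1}"]) auto
  ultimately show ?thesis by simp
qed

lemma deriv_at_pos:
  assumes "(F has_real_derivative D) (at s within {0..})" "s > 0"
  shows "(F has_real_derivative D) (at s)"
proof -
  have "at s within {0..} = at s" using assms(2) by (intro at_within_interior) auto
  then show ?thesis using assms(1) by simp
qed

text \<open>The case f(0) = 0. \<open>f1\<close> and \<open>f2\<close> are f' and f'' on the open
  half line; nothing is prescribed about their values at 0, so later limits at 0 have to come from
  other factors.\<close>

locale convex_nonlinearity =
  fixes f f1 f2 :: "real \<Rightarrow> real"
  assumes f_0: "f 0 = 0" and cont_f: "continuous_on {0..} f"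
    and f_pos: "\<And>s. s > 0 \<Longrightarrow> f s > 0" and f1_pos: "\<And>s. s > 0 \<Longrightarrow> f1 s > 0"
    and f2_nonneg: "\<And>s. s > 0 \<Longrightarrow> f2 s \<ge> 0"
    and deriv_f: "\<And>s. s > 0 \<Longrightarrow> (f has_real_derivative f1 s) (at s)"
    and deriv_f1: "\<And>s. s > 0 \<Longrightarrow> (f1 has_real_derivative f2 s) (at s)"
begin

lemma f1_mono: "0 < s \<Longrightarrow> s \<le> t \<Longrightarrow> f1 s \<le> f1 t"
  by (rule DERIV_nonneg_imp_nondecreasing[of s t f1]) (auto intro!: exI deriv_f1 f2_nonneg)

lemma f_mono: "0 < s \<Longrightarrow> s \<le> t \<Longrightarrow> f s \<le> f t"
  by (rule DERIV_nonneg_imp_nondecreasing[of s t f]) (auto intro!: exI deriv_f less_imp_le[OF f1_pos])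

text \<open>The condition r <= \<sigma> makes f1 f^(-\<sigma>) nonincreasing on (0, \<delta>]; its
  values at s and \<delta> are compared.\<close>

lemma f1_ge_powr:
  assumes "0 < s" "s \<le> \<delta>"
    and le: "\<And>s. 0 < s \<Longrightarrow> s \<le> \<delta> \<Longrightarrow> f s * f2 s \<le> \<sigma> * (f1 s)\<^sup>2"
  shows "f1 \<delta> * f \<delta> powr (- \<sigma>) * f s powr \<sigma> \<le> f1 s"
proof -
  have "f1 \<delta> * f \<delta> powr (- \<sigma>) \<le> f1 s * f s powr (- \<sigma>)"
  proof (rule DERIV_nonpos_imp_nonincreasing[OF assms(2)])
    fix x assume "s \<le> x" "x \<le> \<delta>"
    then have x: "0 < x" "x \<le> \<delta>" using assms(1) by auto
    have "f2 x * f x powr (- \<sigma>) + - \<sigma> * f x powr (- \<sigma> - 1) * f1 x * f1 x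
        = f x powr (- \<sigma> - 1) * (f x * f2 x - \<sigma> * (f1 x)\<^sup>2)"
      using f_pos[OF x(1)] by (simp add: powr_diff field_simps power2_eq_square)
    also have "\<dots> \<le> 0"
      using le[OF x] by (intro mult_nonneg_nonpos) auto
    finally have "f2 x * f x powr (- \<sigma>) + - \<sigma> * f x powr (- \<sigma> - 1) * f1 x * f1 x \<le> 0" .
    moreover have "((\<lambda>s. f1 s * f s powr (- \<sigma>)) has_real_derivative
        f2 x * f x powr (- \<sigma>) + - \<sigma> * f x powr (- \<sigma> - 1) * f1 x * f1 x) (at x)"
      using DERIV_mult[OF deriv_f1[OF x(1)] DERIV_fun_powr[OF deriv_f[OF x(1)] f_pos[OF x(1)], of "- \<sigma>"]]
      by (rule DERIV_cong) simp
    ultimately show "\<exists>y. ((\<lambda>s. f1 s * f s powr (- \<sigma>)) has_real_derivative y) (at x) \<and> y \<le> 0"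
      by blast
  qed
  then have "f1 \<delta> * f \<delta> powr (- \<sigma>) * f s powr \<sigma> \<le> f1 s * f s powr (- \<sigma>) * f s powr \<sigma>"
    by (intro mult_right_mono) auto
  also have "\<dots> = f1 s" using f_pos[OF assms(1)] by (simp add: powr_minus)
  finally show ?thesis .
qed

text \<open>Integrating f' >= const f^\<sigma> from f(0) = 0 gives linear growth of f^(1 -
  \<sigma>), hence the power bound up to \<delta>. From there to M monotonicity suffices with
  another constant. For small \<sigma> the exponent is close to 1.\<close>

lemma f_ge_powr:
  assumes "\<delta> > 0" "0 < \<sigma>" "\<sigma> < 1"
    and le: "\<And>s. 0 < s \<Longrightarrow> s \<le> \<delta> \<Longrightarrow> f s * f2 s \<le> \<sigma> * (f1 s)\<^sup>2"
  shows "\<exists>c>0. \<forall>s. 0 \<le> s \<longrightarrow> s \<le> M \<longrightarrow> c * s powr (1 / (1 - \<sigma>)) \<le> f s"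
proof -
  define \<theta> where "\<theta> = 1 / (1 - \<sigma>)"
  have \<theta>: "\<theta> > 0" using assms by (simp add: \<theta>_def)
  define b where "b = f1 \<delta> * f \<delta> powr (- \<sigma>) * (1 - \<sigma>)"
  have "b > 0" using assms f1_pos[of \<delta>] f_pos[of \<delta>] by (simp add: b_def)
  have small: "b powr \<theta> * s powr \<theta> \<le> f s" if s: "0 < s" "s \<le> \<delta>" for s
  proof -
    have "f 0 powr (1 - \<sigma>) - b * 0 \<le> f s powr (1 - \<sigma>) - b * s"
    proof (rule DERIV_nonneg_imp_increasing_open[where f="\<lambda>s. f s powr (1 - \<sigma>) - b * s"])
      fix x assume "0 < x" "x < s"
      then have x: "0 < x" "x \<le> \<delta>" using s by auto
      have "b = (1 - \<sigma>) * (f1 \<delta> * f \<delta> powr (- \<sigma>) * f x powr \<sigma> * f x powr (- \<sigma>))"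
        using f_pos[OF x(1)] by (simp add: b_def powr_minus)
      also have "\<dots> \<le> (1 - \<sigma>) * (f1 x * f x powr (- \<sigma>))"
        using assms by (intro mult_left_mono mult_right_mono f1_ge_powr x le) auto
      finally have "0 \<le> (1 - \<sigma>) * f x powr (1 - \<sigma> - 1) * f1 x - b * 1" by (simp add: mult_ac)
      moreover have "((\<lambda>s. f s powr (1 - \<sigma>) - b * s) has_real_derivative
          (1 - \<sigma>) * f x powr (1 - \<sigma> - 1) * f1 x - b * 1) (at x)"
        using DERIV_fun_powr[OF deriv_f[OF x(1)] f_pos[OF x(1)], of "1 - \<sigma>"]
        by (intro DERIV_diff DERIV_cmult DERIV_ident) simp
      ultimately show "\<exists>y. ((\<lambda>s. f s powr (1 - \<sigma>) - b * s) has_real_derivative y) (at x) \<and> 0 \<le> y"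
        by blast
    next
      have "f t \<ge> 0" if "t \<ge> 0" for t using that f_pos[of t] f_0 by (cases "t = 0") auto
      then show "continuous_on {0..s} (\<lambda>s. f s powr (1 - \<sigma>) - b * s)"
        using assms by (intro continuous_intros continuous_on_powr' continuous_on_subset[OF cont_f]) auto
    qed (use s in simp)
    then have "b * s \<le> f s powr (1 - \<sigma>)" using assms by (simp add: f_0)
    then have "(b * s) powr \<theta> \<le> (f s powr (1 - \<sigma>)) powr \<theta>"
      using \<open>b > 0\<close> s \<theta> by (intro powr_mono2) auto
    also have "\<dots> = f s" using f_pos[OF s(1)] assms by (simp add: powr_powr \<theta>_def)
    finally show ?thesis using \<open>b > 0\<close> s by (simp add: powr_mult)
  qed
  \<comment> \<open>The absolute value and the summand 1 keep \<open>B\<close> positive and the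
    bound valid for every sign of M.\<close>
  define B where "B = f \<delta> / (\<bar>M\<bar> powr \<theta> + 1)"
  have "B > 0" using f_pos[OF assms(1)] by (simp add: B_def add_nonneg_pos)
  have large: "B * s powr \<theta> \<le> f s" if s: "\<delta> \<le> s" "s \<le> M" for s
  proof -
    have "s powr \<theta> \<le> \<bar>M\<bar> powr \<theta> + 1"
      using powr_mono2[of \<theta> s "\<bar>M\<bar>"] \<theta> s assms(1) by simp
    then have "B * s powr \<theta> \<le> B * (\<bar>M\<bar> powr \<theta> + 1)"
      using \<open>B > 0\<close> by (intro mult_left_mono) auto
    also have "\<dots> = f \<delta>" by (simp add: B_def add_nonneg_eq_0_iff)
    also have "\<dots> \<le> f s" using f_mono[of \<delta> s] assms s by simp
    finally show ?thesis .
  qed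
  show ?thesis
    unfolding \<theta>_def[symmetric]
  proof (intro exI[of _ "min (b powr \<theta>) B"] conjI allI impI)
    show "min (b powr \<theta>) B > 0" using \<open>b > 0\<close> \<open>B > 0\<close> by simp
    fix s assume s: "0 \<le> s" "s \<le> M"
    consider "s = 0" | "0 < s" "s \<le> \<delta>" | "\<delta> \<le> s" using s by linarith
    then show "min (b powr \<theta>) B * s powr \<theta> \<le> f s"
    proof cases
      case 1
      then show ?thesis by (simp add: f_0)
    next
      case 2
      have "min (b powr \<theta>) B * s powr \<theta> \<le> b powr \<theta> * s powr \<theta>" by (intro mult_right_mono) auto
      then show ?thesis using small[OF 2] by linarith
    next
      case 3
      have "min (b powr \<theta>) B * s powr \<theta> \<le> B * s powr \<theta>" by (intro mult_right_mono) auto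
      then show ?thesis using large[OF 3 s(2)] by linarith
    qed
  qed
qed

text \<open>If \<open>f\<close> were log-convex near \<open>0\<close>, then \<open>f1 \<le> C f\<close> there, so \<open>f 0 = 0\<close> would force \<open>f = 0\<close>.
  This is why \<open>q\<^sub>0 \<ge> 1\<close>.\<close>

lemma not_log_convex_near_0:
  assumes "\<delta> > 0"
  shows "\<exists>s. 0 < s \<and> s \<le> \<delta> \<and> f s * f2 s < (f1 s)\<^sup>2"
proof (rule ccontr)
  assume "\<not> ?thesis"
  then have le: "(f1 s)\<^sup>2 \<le> f s * f2 s" if "0 < s" "s \<le> \<delta>" for s
    using that by force
  define C where "C = f1 \<delta> / f \<delta>"
  have f1_le: "f1 s \<le> C * f s" if s: "0 < s" "s \<le> \<delta>" for s
  proof -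
    have "f1 s / f s \<le> f1 \<delta> / f \<delta>"
    proof (rule DERIV_nonneg_imp_nondecreasing[OF s(2)])
      fix x assume "s \<le> x" "x \<le> \<delta>"
      then have x: "0 < x" "x \<le> \<delta>" using s by auto
      have "((\<lambda>s. f1 s / f s) has_real_derivative (f2 x * f x - f1 x * f1 x) / (f x * f x)) (at x)"
        using f_pos[OF x(1)] by (intro DERIV_divide deriv_f deriv_f1 x) auto
      moreover have "0 \<le> (f2 x * f x - f1 x * f1 x) / (f x * f x)"
        using le[OF x] by (simp add: power2_eq_square mult.commute)
      ultimately show "\<exists>y. ((\<lambda>s. f1 s / f s) has_real_derivative y) (at x) \<and> 0 \<le> y" by blast
    qed
    then show ?thesis using f_pos[OF s(1)] by (simp add: C_def field_simps)
  qed
  have "- (f 0 * exp (- C * 0)) \<le> - (f \<delta> * exp (- C * \<delta>))"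
  proof (rule DERIV_nonneg_imp_increasing_open[where f="\<lambda>s. - (f s * exp (- C * s))"])
    fix x assume x: "0 < x" "x < \<delta>"
    have "((\<lambda>s. - (f s * exp (- C * s))) has_real_derivative exp (- C * x) * (C * f x - f1 x)) (at x)"
      by (rule derivative_eq_intros deriv_f x refl)+ (simp add: algebra_simps)
    moreover have "0 \<le> exp (- C * x) * (C * f x - f1 x)"
      using f1_le[of x] x by simp
    ultimately show "\<exists>y. ((\<lambda>s. - (f s * exp (- C * s))) has_real_derivative y) (at x) \<and> 0 \<le> y"
      by blast
  qed (use assms in \<open>auto intro!: continuous_intros continuous_on_subset[OF cont_f]\<close>)
  then show False using f_pos[OF assms] by (simp add: f_0 mult_le_0_iff)
qed

end

text \<open>On (0, \<delta>] the hypotheses read \<beta>^2 + \<epsilon> <= r <= \<sigma>. The lower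
  bound drives the comparison of Y with G, with \<epsilon> as its margin; the upper bound gives the
  growth f1 >= const f^\<sigma>.\<close>

locale profile = convex_nonlinearity +
  fixes \<beta> \<epsilon> \<sigma> \<delta> :: real
  assumes params: "\<beta> > 0" "\<epsilon> > 0" "\<delta> > 0"
    and near_0: "\<And>s. 0 < s \<Longrightarrow> s \<le> \<delta> \<Longrightarrow> (\<beta>\<^sup>2 + \<epsilon>) * (f1 s)\<^sup>2 \<le> f s * f2 s"
      "\<And>s. 0 < s \<Longrightarrow> s \<le> \<delta> \<Longrightarrow> f s * f2 s \<le> \<sigma> * (f1 s)\<^sup>2"
begin

text \<open>The test profile is \<open>g = f \<mu>(f)^\<beta>\<close>. Here \<open>\<mu>\<close> is a \<open>C^1\<close> function comparable to \<open>t\<close> on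
  \<open>[0, f \<delta>]\<close> and constant afterwards, with logarithmic derivative \<open>t \<mu>' / \<mu> = a \<in> [0, 1]\<close>, so that
  \<open>r - \<beta>^2 a^2\<close> stays nonnegative even where nothing is known about \<open>r\<close> beyond \<open>r \<ge> 0\<close>. The function
  \<open>Y\<close> equals \<open>f' g^2 / f\<close>, hence \<open>f' g^2 - f G = f (Y - G)\<close>. At \<open>0\<close> the value \<open>\<mu> 0 = 0\<close> makes
  \<open>g'\<close> and \<open>Y\<close> vanish whatever the value of \<open>f1 0\<close>.\<close>

definition \<mu> :: "real \<Rightarrow> real" where "\<mu> t = (f \<delta>)\<^sup>2 - (max 0 (f \<delta> - t))\<^sup>2"
definition k :: "real \<Rightarrow> real" where "k s = \<mu> (f s) powr \<beta>"
definition a :: "real \<Rightarrow> real" where "a s = f s * (2 * max 0 (f \<delta> - f s)) / \<mu> (f s)"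
definition g :: "real \<Rightarrow> real" where "g s = f s * k s"
definition g' :: "real \<Rightarrow> real" where "g' s = f1 s * k s * (1 + \<beta> * a s)"
definition Y :: "real \<Rightarrow> real" where "Y s = f1 s * f s * (k s)\<^sup>2"
definition Y' :: "real \<Rightarrow> real" where
  "Y' s = (f s * f2 s + (f1 s)\<^sup>2 * (1 + 2 * \<beta> * a s)) * (k s)\<^sup>2"
definition G :: "real \<Rightarrow> real" where "G s = integral {0..s} (\<lambda>t. (g' t)\<^sup>2)"
definition L :: "real \<Rightarrow> real" where "L s = (g s)\<^sup>2 / 2 - integral {0..s} G"

section \<open>Regularity of the profile up to 0\<close>

lemma f_le_linear: "0 < s \<Longrightarrow> s \<le> \<delta> \<Longrightarrow> f s \<le> s * f1 \<delta>"
proof -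
  assume s: "0 < s" "s \<le> \<delta>"
  have "\<exists>l z. 0 < z \<and> z < s \<and> (f has_real_derivative l) (at z) \<and> f s - f 0 = (s - 0) * l"
    using s(1)
    by (intro MVT) (auto intro: continuous_on_subset[OF cont_f] simp: real_differentiable_def intro!: exI deriv_f)
  then obtain l z where z: "0 < z" "z < s" "(f has_real_derivative l) (at z)" "f s = s * l"
    by (auto simp: f_0)
  have "l = f1 z" by (rule DERIV_unique[OF z(3) deriv_f[OF z(1)]])
  then have "l \<le> f1 \<delta>" using f1_mono[of z \<delta>] z s by simp
  then show ?thesis using z s by simp
qed

lemma mu_eq: "0 \<le> t \<Longrightarrow> t \<le> f \<delta> \<Longrightarrow> \<mu> t = t * (2 * f \<delta> - t)"
  by (simp add: \<mu>_def max_def algebra_simps power2_eq_square)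

lemma mu_eq': "t \<ge> f \<delta> \<Longrightarrow> \<mu> t = (f \<delta>)\<^sup>2"
  by (simp add: \<mu>_def max_def)

lemma mu_pos: "t > 0 \<Longrightarrow> \<mu> t > 0"
  using f_pos[OF params(3)] by (cases "t \<le> f \<delta>") (auto simp: mu_eq mu_eq')

lemma k_pos: "s > 0 \<Longrightarrow> k s > 0"
  using mu_pos[OF f_pos[of s]] by (simp add: k_def)

lemma k_0: "k 0 = 0"
  by (simp add: k_def \<mu>_def f_0 f_pos[OF params(3), THEN less_imp_le])

lemma g_pos: "s > 0 \<Longrightarrow> g s > 0"
  by (simp add: g_def k_pos f_pos)

text \<open>Where f s <= f \<delta> the quotient is 2 (f \<delta> - f s) / (2 f \<delta> - f s);
  beyond that it is 0.\<close>

lemma a_bounds: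
  assumes "s > 0" shows "0 \<le> a s" "a s \<le> 1" 
proof -
  have fs: "f s > 0" by (rule f_pos[OF assms])
  have m: "\<mu> (f s) > 0" by (rule mu_pos[OF fs])
  show "0 \<le> a s" using fs m by (simp add: a_def)
  have "f s * (2 * max 0 (f \<delta> - f s)) \<le> \<mu> (f s)"
  proof (cases "f s \<le> f \<delta>")
    case True
    then show ?thesis using fs by (simp add: mu_eq max_def)
  next
    case False
    then show ?thesis using m by simp
  qed
  then show "a s \<le> 1" using m by (simp add: a_def)
qed

lemma a_eq_0: "s \<ge> \<delta> \<Longrightarrow> a s = 0"
  using f_mono[of \<delta> s] params by (simp add: a_def)

lemma deriv_mu: "(\<mu> has_real_derivative 2 * max 0 (f \<delta> - t)) (at t)"
proof -
  have "((\<lambda>t. f \<delta> - t) has_real_derivative -1) (at t)"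
    by (auto intro!: derivative_eq_intros)
  from DERIV_chain2[OF has_real_derivative_max_power[of 2] this]
  have "((\<lambda>t. (max 0 (f \<delta> - t))\<^sup>2) has_real_derivative - (2 * max 0 (f \<delta> - t))) (at t)"
    by simp
  from DERIV_diff[OF DERIV_const this] show ?thesis by (simp add: \<mu>_def[abs_def])
qed

lemma deriv_k:
  assumes "s > 0"
  shows "(k has_real_derivative k s * \<beta> * a s * f1 s / f s) (at s)"
proof -
  have fs: "f s > 0" by (rule f_pos[OF assms])
  have m: "\<mu> (f s) > 0" by (rule mu_pos[OF fs])
  have "((\<lambda>s. \<mu> (f s)) has_real_derivative 2 * max 0 (f \<delta> - f s) * f1 s) (at s)"
    by (rule DERIV_chain2[OF deriv_mu deriv_f[OF assms]])
  from DERIV_fun_powr[OF this m, of \<beta>] show ?thesis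
    using fs m by (simp add: k_def[abs_def] a_def powr_diff field_simps)
qed

lemma deriv_g_pos: 
  assumes "s > 0" shows "(g has_real_derivative g' s) (at s)"
proof -
  from DERIV_mult[OF deriv_f[OF assms] deriv_k[OF assms]] show ?thesis
    using f_pos[OF assms] by (simp add: g_def[abs_def] g'_def algebra_simps)
qed

lemma deriv_Y:
  assumes "s > 0" shows "(Y has_real_derivative Y' s) (at s)"
proof -
  have "((\<lambda>s. (k s)\<^sup>2) has_real_derivative 2 * k s * (k s * \<beta> * a s * f1 s / f s)) (at s)"
    using DERIV_power[OF deriv_k[OF assms], of 2] by (rule DERIV_cong) simp
  from DERIV_mult[OF DERIV_mult[OF deriv_f1[OF assms] deriv_f[OF assms]] this] show ?thesis
    unfolding Y_def[abs_def] Y'_def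
    by (rule DERIV_cong) (use f_pos[OF assms] in \<open>simp add: field_simps power2_eq_square\<close>)
qed

lemma cont_k: "continuous_on {0..} k"
proof -
  have "continuous_on UNIV \<mu>"
    by (intro continuous_at_imp_continuous_on ballI DERIV_isCont[OF deriv_mu])
  then have "continuous_on {0..} (\<lambda>s. \<mu> (f s))"
    by (rule continuous_on_compose2[OF _ cont_f]) auto
  moreover have "\<mu> (f s) \<ge> 0" if "s \<ge> 0" for s
  proof (cases "s = 0")
    case True
    then show ?thesis by (simp add: \<mu>_def f_0 f_pos[OF params(3), THEN less_imp_le])
  next
    case False
    then show ?thesis using that mu_pos[OF f_pos[of s]] by simp
  qed
  ultimately show ?thesis
    unfolding k_def[abs_def] using params by (intro continuous_on_powr' continuous_intros) auto
qed

lemma tendsto_k_0: "(k \<longlongrightarrow> 0) (at 0 within {0..})"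
  using cont_k bspec[of "{0..}" "\<lambda>x. (k \<longlongrightarrow> k x) (at x within {0..})" 0]
  by (simp add: continuous_on_def k_0)

text \<open>Domination by a multiple of k, which vanishes at 0, replaces information on f1 at 0. It
  is applied to g' and Y, which both carry a factor k.\<close>

lemma continuous_on_from_pos:
  assumes "continuous_on {0<..} F" "F 0 = 0"
    and bd: "\<And>s. 0 < s \<Longrightarrow> s \<le> \<delta> \<Longrightarrow> \<bar>F s\<bar> \<le> K * k s"
  shows "continuous_on {0..} F"
  unfolding continuous_on_eq_continuous_within
proof
  fix s :: real assume "s \<in> {0..}"
  show "continuous (at s within {0..}) F"
  proof (cases "s = 0")
    case True
    have "(F \<longlongrightarrow> 0) (at 0 within {0..})"
    proof (rule Lim_null_comparison)
      show "\<forall>\<^sub>F s in at 0 within {0..}. norm (F s) \<le> K * k s"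
        unfolding eventually_at
        by (rule exI[of _ \<delta>]) (use params bd in \<open>auto simp: dist_real_def\<close>)
      show "((\<lambda>s. K * k s) \<longlongrightarrow> 0) (at 0 within {0..})"
        using tendsto_mult_right_zero[OF tendsto_k_0] by simp
    qed
    then show ?thesis using True assms(2) by (simp add: continuous_within)
  next
    case False
    then have "s \<in> {0<..}" using \<open>s \<in> {0..}\<close> by auto
    then have "isCont F s"
      using assms(1) by (simp add: continuous_on_eq_continuous_at)
    then show ?thesis by (rule continuous_at_imp_continuous_at_within)
  qed
qed

lemma cont_pos:
  "continuous_on {0<..} f" "continuous_on {0<..} f1" "continuous_on {0<..} k" "continuous_on {0<..} a"
proof -
  show f: "continuous_on {0<..} f"
    by (intro continuous_at_imp_continuous_on ballI DERIV_isCont[OF deriv_f]) simp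
  show "continuous_on {0<..} f1"
    by (intro continuous_at_imp_continuous_on ballI DERIV_isCont[OF deriv_f1]) simp
  show "continuous_on {0<..} k"
    by (intro continuous_at_imp_continuous_on ballI DERIV_isCont[OF deriv_k]) simp
  have "continuous_on UNIV \<mu>"
    by (intro continuous_at_imp_continuous_on ballI DERIV_isCont[OF deriv_mu])
  then have m: "continuous_on {0<..} (\<lambda>s. \<mu> (f s))"
    by (rule continuous_on_compose2[OF _ f]) auto
  show "continuous_on {0<..} a"
    unfolding a_def[abs_def]
    by (intro continuous_intros f m) (use mu_pos f_pos in \<open>force\<close>)
qed

lemma cont_g': "continuous_on {0..} g'"
proof (rule continuous_on_from_pos)
  show "continuous_on {0<..} g'"
    unfolding g'_def[abs_def] by (intro continuous_intros cont_pos)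
  show "g' 0 = 0" by (simp add: g'_def k_0)
  fix s assume s: "0 < s" "s \<le> \<delta>"
  have "g' s = (f1 s * (1 + \<beta> * a s)) * k s" by (simp add: g'_def)
  moreover have "f1 s * (1 + \<beta> * a s) \<le> f1 \<delta> * (1 + \<beta> * 1)"
    using f1_mono[OF s] a_bounds[OF s(1)] params f1_pos[OF s(1)] 
    by (intro mult_mono add_left_mono mult_left_mono) auto
  moreover have "0 \<le> g' s"
    using f1_pos[OF s(1)] k_pos[OF s(1)] a_bounds[OF s(1)] params by (simp add: g'_def)
  ultimately show "\<bar>g' s\<bar> \<le> (f1 \<delta> * (1 + \<beta> * 1)) * k s"
    using k_pos[OF s(1)] by (simp add: mult_right_mono)
qed

lemma k_le: "s > 0 \<Longrightarrow> k s \<le> ((f \<delta>)\<^sup>2) powr \<beta>"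
  unfolding k_def using params mu_pos[OF f_pos[of s]]
  by (intro powr_mono2) (auto simp: \<mu>_def less_imp_le)

lemma f1_f_k_bounded:
  assumes "0 < s" "s \<le> \<delta>" 
  shows "f1 s * f s * k s \<le> f1 \<delta> * f \<delta> * ((f \<delta>)\<^sup>2) powr \<beta>"
  using f1_mono[OF assms] f_mono[OF assms] k_le[OF assms(1)] f1_pos[OF assms(1)] f_pos[OF assms(1)]
    k_pos[OF assms(1)] f1_pos[OF params(3)] f_pos[OF params(3)]
  by (intro mult_mono) auto

lemma cont_Y: "continuous_on {0..} Y"
proof (rule continuous_on_from_pos)
  show "continuous_on {0<..} Y"
    unfolding Y_def[abs_def] by (intro continuous_intros cont_pos)
  show "Y 0 = 0" by (simp add: Y_def k_0)
  fix s assume s: "0 < s" "s \<le> \<delta>"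
  have "Y s = (f1 s * f s * k s) * k s" by (simp add: Y_def power2_eq_square)
  then show "\<bar>Y s\<bar> \<le> (f1 \<delta> * f \<delta> * ((f \<delta>)\<^sup>2) powr \<beta>) * k s"
    using f1_f_k_bounded[OF s] k_pos[OF s(1)] f1_pos[OF s(1)] f_pos[OF s(1)]
    by (simp add: mult_right_mono)
qed

lemma deriv_g: 
  assumes "s \<ge> 0" shows "(g has_real_derivative g' s) (at s within {0..})"
proof (cases "s = 0")
  case True
  \<comment> \<open>The quotient is (f s / s) k s; its first factor stays below f1 \<delta> by
    convexity, and k tends to 0.\<close>
  have "((\<lambda>s. g s / s) \<longlongrightarrow> 0) (at 0 within {0..})"
  proof (rule Lim_null_comparison)
    show "\<forall>\<^sub>F s in at 0 within {0..}. norm (g s / s) \<le> f1 \<delta> * k s"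
      unfolding eventually_at
    proof (intro exI[of _ \<delta>] conjI ballI impI)
      fix s :: real assume "s \<in> {0..}" "s \<noteq> 0 \<and> dist s 0 < \<delta>"
      then have s: "0 < s" "s \<le> \<delta>" by (auto simp: dist_real_def)
      have "f s / s \<le> f1 \<delta>" using f_le_linear[OF s] s by (simp add: field_simps)
      then have "f s / s * k s \<le> f1 \<delta> * k s" using k_pos[OF s(1)] by (intro mult_right_mono) auto
      then show "norm (g s / s) \<le> f1 \<delta> * k s"
        using g_pos[OF s(1)] s by (simp add: g_def)
    qed (use params in simp)
    show "((\<lambda>s. f1 \<delta> * k s) \<longlongrightarrow> 0) (at 0 within {0..})"
      using tendsto_mult_right_zero[OF tendsto_k_0] by simp
  qed
  then show ?thesis
    using True by (simp add: has_field_derivative_iff g_def g'_def k_0 f_0)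
next
  case False
  then show ?thesis using deriv_g_pos[of s] assms by (simp add: has_field_derivative_at_within)
qed

lemma deriv_G: "s \<ge> 0 \<Longrightarrow> (G has_real_derivative (g' s)\<^sup>2) (at s within {0..})"
  unfolding G_def[abs_def]
  by (rule has_real_derivative_integral_nonneg) (intro continuous_intros cont_g')

lemma cont_G: "continuous_on {0..} G"
  unfolding continuous_on_eq_continuous_within by (auto intro!: DERIV_continuous[OF deriv_G])

lemma deriv_L:
  assumes "s \<ge> 0" shows "(L has_real_derivative g s * g' s - G s) (at s within {0..})"
proof -
  have "((\<lambda>s. (g s)\<^sup>2 / 2) has_real_derivative g s * g' s) (at s within {0..})"
    by (rule derivative_eq_intros deriv_g[OF assms] refl | simp)+
  from DERIV_diff[OF this has_real_derivative_integral_nonneg[OF cont_G assms]]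
  show ?thesis by (simp add: L_def[abs_def])
qed

section \<open>Comparison of Y with G and coercivity\<close>

lemma G_nonneg: "G s \<ge> 0"
  unfolding G_def by (cases "0 \<le> s") 
    (auto intro!: Henstock_Kurzweil_Integration.integral_nonneg integrable_continuous_real
      continuous_intros continuous_on_subset[OF cont_g'])

text \<open>The terms 1 + 2 \<beta> a cancel between Y' and the square of 1 + \<beta> a, leaving
  f1^2 k^2 (r - \<beta>^2 a^2). This is where \<beta>^2 < \<rho> pays off.\<close>

lemma Y'_minus:
  "Y' s - (g' s)\<^sup>2 = (k s)\<^sup>2 * (f s * f2 s - \<beta>\<^sup>2 * (a s)\<^sup>2 * (f1 s)\<^sup>2)"
  by (simp add: Y'_def g'_def power2_eq_square algebra_simps)

lemma a_sq_le: "s > 0 \<Longrightarrow> \<beta>\<^sup>2 * (a s)\<^sup>2 * (f1 s)\<^sup>2 \<le> \<beta>\<^sup>2 * (f1 s)\<^sup>2"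
  using a_bounds[of s] by (intro mult_right_mono mult_left_le power_le_one) auto

text \<open>Up to \<delta> the derivative is nonnegative by the lower bound on r and a <= 1; beyond
  \<delta> the flatness of \<mu> makes a = 0, and convexity alone suffices.\<close>

lemma Y_minus_G_mono:
  assumes "0 \<le> s" "s \<le> t" shows "Y s - G s \<le> Y t - G t"
proof (rule DERIV_nonneg_imp_increasing_open[OF assms(2)])
  fix x assume "s < x" "x < t"
  then have x: "x > 0" using assms by simp
  have "Y' x - (g' x)\<^sup>2 \<ge> 0"
  proof (cases "x \<le> \<delta>")
    case True
    have "\<beta>\<^sup>2 * (f1 x)\<^sup>2 \<le> (\<beta>\<^sup>2 + \<epsilon>) * (f1 x)\<^sup>2" using params by (intro mult_right_mono) auto
    then show ?thesis
      unfolding Y'_minus using near_0(1)[OF x True] a_sq_le[OF x] by (intro mult_nonneg_nonneg) auto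
  next
    case False
    then show ?thesis
      unfolding Y'_minus using f_pos[OF x] f2_nonneg[OF x] by (simp add: a_eq_0)
  qed
  moreover have "((\<lambda>s. Y s - G s) has_real_derivative Y' x - (g' x)\<^sup>2) (at x)"
    using x by (intro DERIV_diff deriv_Y deriv_at_pos[OF deriv_G]) auto
  ultimately show "\<exists>y. ((\<lambda>s. Y s - G s) has_real_derivative y) (at x) \<and> 0 \<le> y" by blast
qed (use assms in \<open>auto intro!: continuous_intros continuous_on_subset[OF cont_Y] continuous_on_subset[OF cont_G]\<close>)

lemma G_0: "G 0 = 0" and Y_0: "Y 0 = 0" and g_0: "g 0 = 0" and L_0: "L 0 = 0"
  by (simp_all add: G_def Y_def g_def L_def k_0)

lemma G_le_Y: "s \<ge> 0 \<Longrightarrow> G s \<le> Y s"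
  using Y_minus_G_mono[of 0 s] by (simp add: G_0 Y_0)

lemma sigma_pos: "\<sigma> > 0"
proof -
  have "0 < (\<beta>\<^sup>2 + \<epsilon>) * (f1 \<delta>)\<^sup>2" using params f1_pos[of \<delta>] by (simp add: add_nonneg_pos)
  also have "\<dots> \<le> \<sigma> * (f1 \<delta>)\<^sup>2" using near_0[of \<delta>] params by simp
  finally show ?thesis by (simp add: zero_less_mult_iff)
qed

text \<open>The denominator bounds Y' / (f1^2 k^2) on (0, \<delta>], so c1 Y' is at most \<epsilon>
  f1^2 k^2, the guaranteed surplus of Y' over g'^2.\<close>

definition c1 :: real where "c1 = \<epsilon> / (\<sigma> + 1 + 2 * \<beta>)"

lemma c1_pos: "c1 > 0"
  using params sigma_pos by (simp add: c1_def)

text \<open>Both sides vanish at 0, and by the choice of \<open>c1\<close> their derivatives are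
  ordered on (0, \<delta>].\<close>

lemma Y_minus_G_near_0:
  assumes "0 \<le> s" "s \<le> \<delta>" shows "c1 * Y s \<le> Y s - G s"
proof -
  have "(Y 0 - G 0) - c1 * Y 0 \<le> (Y s - G s) - c1 * Y s"
  proof (rule DERIV_nonneg_imp_increasing_open[OF assms(1)])
    fix x assume x: "0 < x" "x < s"
    then have x\<delta>: "x \<le> \<delta>" using assms by simp
    have "f x * f2 x + (f1 x)\<^sup>2 * (1 + 2 * \<beta> * a x) \<le> \<sigma> * (f1 x)\<^sup>2 + (f1 x)\<^sup>2 * (1 + 2 * \<beta> * 1)"
      using near_0(2)[OF x(1) x\<delta>] a_bounds[OF x(1)] params
      by (intro add_mono mult_left_mono) auto
    then have "c1 * (f x * f2 x + (f1 x)\<^sup>2 * (1 + 2 * \<beta> * a x)) \<le> c1 * ((\<sigma> + 1 + 2 * \<beta>) * (f1 x)\<^sup>2)"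
      using c1_pos by (intro mult_left_mono) (auto simp: algebra_simps)
    also have "\<dots> = \<epsilon> * (f1 x)\<^sup>2" using params sigma_pos by (simp add: c1_def)
    also have "\<dots> \<le> f x * f2 x - \<beta>\<^sup>2 * (a x)\<^sup>2 * (f1 x)\<^sup>2"
      using near_0(1)[OF x(1) x\<delta>] a_sq_le[OF x(1)] by (simp add: algebra_simps)
    finally have "(k x)\<^sup>2 * (c1 * (f x * f2 x + (f1 x)\<^sup>2 * (1 + 2 * \<beta> * a x)))
      \<le> (k x)\<^sup>2 * (f x * f2 x - \<beta>\<^sup>2 * (a x)\<^sup>2 * (f1 x)\<^sup>2)" by (intro mult_left_mono) auto
    then have "0 \<le> Y' x - (g' x)\<^sup>2 - c1 * Y' x"
      unfolding Y'_minus by (simp add: Y'_def algebra_simps)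
    moreover have "((\<lambda>s. (Y s - G s) - c1 * Y s) has_real_derivative Y' x - (g' x)\<^sup>2 - c1 * Y' x) (at x)"
      using x by (intro DERIV_diff DERIV_cmult deriv_Y deriv_at_pos[OF deriv_G]) auto
    ultimately show "\<exists>y. ((\<lambda>s. (Y s - G s) - c1 * Y s) has_real_derivative y) (at x) \<and> 0 \<le> y" by blast
  qed (use assms in \<open>auto intro!: continuous_intros continuous_on_subset[OF cont_Y] continuous_on_subset[OF cont_G]\<close>)
  then show ?thesis by (simp add: G_0 Y_0)
qed

lemma Y_pos: "s > 0 \<Longrightarrow> Y s > 0"
  by (auto simp: Y_def intro!: mult_pos_pos f_pos f1_pos zero_less_power k_pos)

text \<open>From above, L is at most half of g^2 because G is nonnegative. From below, L is
  nondecreasing from 0, since g g' = Y (1 + \<beta> a) >= Y >= G.\<close>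

lemma abs_L_le:
  assumes "s \<ge> 0" shows "\<bar>L s\<bar> \<le> (g s)\<^sup>2"
proof -
  have "integral {0..s} G \<ge> 0"
    by (intro Henstock_Kurzweil_Integration.integral_nonneg integrable_continuous_real
        continuous_on_subset[OF cont_G]) (auto simp: G_nonneg)
  then have 1: "L s \<le> (g s)\<^sup>2" by (simp add: L_def) (smt (verit) zero_le_power2 field_sum_of_halves)
  have "L 0 \<le> L s"
  proof (rule DERIV_nonneg_imp_increasing_open[OF assms])
    fix x assume x: "0 < x" "x < s"
    have "g x * g' x = Y x * (1 + \<beta> * a x)"
      by (simp add: g_def g'_def Y_def power2_eq_square)
    moreover have "Y x * 1 \<le> Y x * (1 + \<beta> * a x)"
      using Y_pos[OF x(1)] a_bounds[OF x(1)] params by (intro mult_left_mono) auto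
    ultimately have "0 \<le> g x * g' x - G x" using G_le_Y[of x] x by simp
    moreover have "(L has_real_derivative g x * g' x - G x) (at x)"
      using x by (intro deriv_at_pos[OF deriv_L]) auto
    ultimately show "\<exists>y. (L has_real_derivative y) (at x) \<and> 0 \<le> y" by blast
  next
    have "continuous_on {0..} L"
      unfolding continuous_on_eq_continuous_within by (auto intro!: DERIV_continuous[OF deriv_L])
    then show "continuous_on {0..s} L" by (rule continuous_on_subset) auto
  qed
  then show ?thesis using 1 by (simp add: L_0)
qed

text \<open>On this range \<mu> t <= 2 (f \<delta>) t. The bound turns powers of f into powers of g
  in the coercivity estimate.\<close>

lemma g_le_f:
  assumes "0 < s" "s \<le> \<delta>"
  shows "g s \<le> (2 * f \<delta>) powr \<beta> * f s powr (1 + \<beta>)"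
proof -
  have fs: "0 < f s" "f s \<le> f \<delta>" using f_pos f_mono assms by auto
  have "\<mu> (f s) \<le> 2 * f \<delta> * f s" using fs by (simp add: mu_eq algebra_simps)
  then have "k s \<le> (2 * f \<delta> * f s) powr \<beta>"
    unfolding k_def using params mu_pos[OF fs(1)] by (intro powr_mono2) auto
  also have "\<dots> = (2 * f \<delta>) powr \<beta> * f s powr \<beta>" using fs by (simp add: powr_mult)
  finally have "f s * k s \<le> f s * ((2 * f \<delta>) powr \<beta> * f s powr \<beta>)"
    using fs by (intro mult_left_mono) auto
  also have "\<dots> = (2 * f \<delta>) powr \<beta> * f s powr (1 + \<beta>)"
    using fs by (simp add: powr_add)
  finally show ?thesis by (simp add: g_def)
qed

text \<open>Near 0 the chain is f (Y - G) >= c1 f Y = c1 f1 g^2 >= const f^\<sigma> g^2 >= const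
  g^(2 + \<sigma> / (1 + \<beta>)), and the last exponent is 2 \<theta>. On [\<delta>, M] the right
  side is bounded below by monotonicity, and g is bounded.\<close>

lemma coercivity:
  assumes "M > 0"
  defines "\<theta> \<equiv> 1 + \<sigma> / (2 * (1 + \<beta>))"
  shows "\<exists>c>0. \<forall>s. 0 \<le> s \<longrightarrow> s \<le> M \<longrightarrow> c * (g s)\<^sup>2 powr \<theta> \<le> f1 s * (g s)\<^sup>2 - f s * G s"
proof -
  have \<theta>: "\<theta> > 0" using params sigma_pos by (simp add: \<theta>_def add_pos_pos)
  have f\<delta>: "f \<delta> > 0" using f_pos params by simp
  have eq: "f1 s * (g s)\<^sup>2 - f s * G s = f s * (Y s - G s)" for s
    by (simp add: g_def Y_def power2_eq_square algebra_simps)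
  \<comment> \<open>Since g is at most a multiple of f^(1 + \<beta>), its power \<open>e\<close> is
    at most a multiple of f^\<sigma>.\<close>
  define e where "e = \<sigma> / (1 + \<beta>)"
  define A where "A = c1 * (f1 \<delta> * f \<delta> powr (- \<sigma>) * ((2 * f \<delta>) powr (- \<beta>)) powr e)"
  have "A > 0" using c1_pos f1_pos[OF params(3)] f\<delta> by (simp add: A_def)
  have small: "A * (g s)\<^sup>2 powr \<theta> \<le> f1 s * (g s)\<^sup>2 - f s * G s" if s: "0 < s" "s \<le> \<delta>" for s
  proof -
    have fs: "f s > 0" and gs: "g s > 0" using f_pos g_pos s by auto
    have "(2 * f \<delta>) powr (- \<beta>) * g s \<le> (2 * f \<delta>) powr (- \<beta>) * ((2 * f \<delta>) powr \<beta> * f s powr (1 + \<beta>))"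
      by (intro mult_left_mono g_le_f s) auto
    also have "\<dots> = f s powr (1 + \<beta>)" using f\<delta> by (simp add: powr_minus)
    finally have "((2 * f \<delta>) powr (- \<beta>) * g s) powr e \<le> (f s powr (1 + \<beta>)) powr e"
      using gs sigma_pos params by (intro powr_mono2) (auto simp: e_def)
    also have "\<dots> = f s powr \<sigma>" using params by (simp add: powr_powr e_def)
    finally have 1: "((2 * f \<delta>) powr (- \<beta>)) powr e * g s powr e \<le> f s powr \<sigma>"
      using gs by (simp add: powr_mult)
    have "(g s)\<^sup>2 powr \<theta> = g s powr (2 * \<theta>)"
      using gs by (simp add: powr_powr flip: powr_numeral)
    also have "2 * \<theta> = 2 + e" using params by (simp add: \<theta>_def e_def field_simps)
    also have "g s powr (2 + e) = (g s)\<^sup>2 * g s powr e" using gs by (simp add: powr_add powr_numeral)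
    finally have "A * (g s)\<^sup>2 powr \<theta>
       = c1 * (g s)\<^sup>2 * (f1 \<delta> * f \<delta> powr (- \<sigma>) * (((2 * f \<delta>) powr (- \<beta>)) powr e * g s powr e))"
      by (simp add: A_def)
    also have "\<dots> \<le> c1 * (g s)\<^sup>2 * (f1 \<delta> * f \<delta> powr (- \<sigma>) * f s powr \<sigma>)"
      using c1_pos f1_pos[OF params(3)] by (intro mult_left_mono 1) auto
    also have "\<dots> \<le> c1 * (g s)\<^sup>2 * f1 s"
      using c1_pos by (intro mult_left_mono f1_ge_powr s near_0(2)) auto
    also have "\<dots> = f s * (c1 * Y s)" by (simp add: g_def Y_def power2_eq_square)
    also have "\<dots> \<le> f s * (Y s - G s)"
      using fs s by (intro mult_left_mono Y_minus_G_near_0) auto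
    finally show ?thesis unfolding eq .
  qed
  define K where "K = (f M * ((f \<delta>)\<^sup>2) powr \<beta>)\<^sup>2 powr \<theta>"
  define B where "B = f \<delta> * (c1 * Y \<delta>) / (K + 1)"
  have "K \<ge> 0" by (simp add: K_def)
  have "B > 0" using c1_pos f\<delta> Y_pos[OF params(3)] \<open>K \<ge> 0\<close> by (simp add: B_def)
  have large: "B * (g s)\<^sup>2 powr \<theta> \<le> f1 s * (g s)\<^sup>2 - f s * G s" if s: "\<delta> \<le> s" "s \<le> M" for s
  proof -
    have s0: "s > 0" using s params by simp
    have "g s \<le> f M * ((f \<delta>)\<^sup>2) powr \<beta>"
      unfolding g_def using f_mono[OF s0 s(2)] k_le[OF s0] f_pos[OF s0] k_pos[OF s0]
      by (intro mult_mono) auto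
    then have "(g s)\<^sup>2 powr \<theta> \<le> K"
      unfolding K_def using g_pos[OF s0] \<theta> by (intro powr_mono2 power_mono) auto
    then have "B * (g s)\<^sup>2 powr \<theta> \<le> B * (K + 1)"
      using \<open>B > 0\<close> by (intro mult_left_mono) auto
    also have "\<dots> = f \<delta> * (c1 * Y \<delta>)" using \<open>K \<ge> 0\<close> by (simp add: B_def)
    also have "\<dots> \<le> f s * (Y s - G s)"
    proof (intro mult_mono)
      show "f \<delta> \<le> f s" using f_mono[of \<delta> s] params s by simp
      have "c1 * Y \<delta> \<le> Y \<delta> - G \<delta>" using params by (intro Y_minus_G_near_0) auto
      also have "\<dots> \<le> Y s - G s" using params s by (intro Y_minus_G_mono) auto
      finally show "c1 * Y \<delta> \<le> Y s - G s" .
    qed (use f_pos[OF s0] c1_pos Y_pos[OF params(3)] in auto)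
    finally show ?thesis unfolding eq .
  qed
  show ?thesis
  proof (intro exI[of _ "min A B"] conjI allI impI)
    show "min A B > 0" using \<open>A > 0\<close> \<open>B > 0\<close> by simp
    fix s assume s: "0 \<le> s" "s \<le> M"
    consider "s = 0" | "0 < s" "s \<le> \<delta>" | "\<delta> \<le> s" using s by linarith
    then show "min A B * (g s)\<^sup>2 powr \<theta> \<le> f1 s * (g s)\<^sup>2 - f s * G s"
    proof cases
      case 1
      then show ?thesis by (simp add: g_0 G_0)
    next
      case 2
      have "min A B * (g s)\<^sup>2 powr \<theta> \<le> A * (g s)\<^sup>2 powr \<theta>" by (intro mult_right_mono) auto
      then show ?thesis using small[OF 2] by linarith
    next
      case 3
      have "min A B * (g s)\<^sup>2 powr \<theta> \<le> B * (g s)\<^sup>2 powr \<theta>" by (intro mult_right_mono) auto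
      then show ?thesis using large[OF 3 s(2)] by linarith
    qed
  qed
qed

end

section \<open>Liouville theorems\<close>

text \<open>The integral estimates lose two powers of the cutoff; because \<theta> > 1, a large
  exponent still meets the weight condition of Young's inequality.\<close>

lemma ex_cutoff_exponent:
  assumes "(\<theta>::real) > 1"
  shows "\<exists>m\<ge>3. real m \<le> real (m - 2) * \<theta>"
proof -
  obtain m :: nat where m: "real m \<ge> max 3 (2 * \<theta> / (\<theta> - 1))"
    using real_arch_simple by blast
  then have "m \<ge> 3" by simp
  moreover have "2 * \<theta> \<le> real m * (\<theta> - 1)"
    using m assms by (simp add: pos_divide_le_eq)
  ultimately show ?thesis
    by (intro exI[of _ m]) (simp add: of_nat_diff algebra_simps)
qed

text \<open>\<open>integral_weak_estimate\<close> and the lower bound on f feed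
  \<open>vanishing_of_cutoff_estimate\<close> with w = u. For N > 2 the dimension condition is
  Serrin's range \<theta> < N / (N - 2).\<close>

lemma liouville_supersolution:
  fixes u :: "real ^ 'n \<Rightarrow> real"
  assumes u: "C2_space u" "\<And>x. u x \<ge> 0" "\<And>x. u x \<le> M" and eq: "\<And>x. - laplacian u x = f (u x)"
    and f: "continuous_on {0..} f" and "c > 0" "\<theta> > 1"
    and lower: "\<And>s. 0 \<le> s \<Longrightarrow> s \<le> M \<Longrightarrow> c * s powr \<theta> \<le> f s"
    and dim: "real CARD('n) < 2 * \<theta> / (\<theta> - 1)"
  shows "u x = 0"
proof -
  obtain n where n: "n \<ge> 3" "real n \<le> real (n - 2) * \<theta>"
    using ex_cutoff_exponent[OF \<open>\<theta> > 1\<close>] by blast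
  have cu: "continuous_on UNIV u"
    using u(1) by (intro C1_space_continuous) (simp add: C2_space_def)
  show ?thesis
  proof (rule vanishing_of_cutoff_estimate[where w=u and k=n and l="n - 2" and c=c
        and C="4 * (real n)\<^sup>2 + 2 * real n * real CARD('n)" and \<theta>=\<theta>])
    show "0 < 4 * (real n)\<^sup>2 + 2 * real n * real CARD('n)"
      using n by (intro add_pos_nonneg) auto
    show "real DIM(real ^ 'n) < 2 * \<theta> / (\<theta> - 1)" using dim by simp
    fix R :: real assume R: "R \<ge> 1"
    have i1: "integrable lborel (\<lambda>x. u x powr \<theta> * cutoff R n x)"
      by (rule integrable_compact_support[where R=R])
        (use R n \<open>\<theta> > 1\<close> u(2) in \<open>auto intro!: continuous_intros continuous_on_powr' cu continuous_on_cutoff simp: cutoff_eq_0\<close>)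
    have i2: "integrable lborel (\<lambda>x. f (u x) * cutoff R n x)"
      by (rule integrable_compact_support[where R=R])
        (use R n in \<open>auto intro!: continuous_intros continuous_on_compose_nonneg[OF f cu u(2)] continuous_on_cutoff simp: cutoff_eq_0\<close>)
    have "c * (LINT x|lborel. u x powr \<theta> * cutoff R n x) = (LINT x|lborel. c * (u x powr \<theta> * cutoff R n x))"
      by simp
    also have "\<dots> \<le> (LINT x|lborel. f (u x) * cutoff R n x)"
    proof (rule integral_mono)
      fix x
      show "c * (u x powr \<theta> * cutoff R n x) \<le> f (u x) * cutoff R n x"
        using mult_right_mono[OF lower[OF u(2,3)] cutoff_nonneg[of R n x], of x] by (simp add: mult.assoc)
    qed (use i1 i2 in auto)
    also have "\<dots> \<le> (4 * (real n)\<^sup>2 + 2 * real n * real CARD('n)) / R\<^sup>2 * (LINT x|lborel. u x * cutoff R (n - 2) x)"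
      using R by (intro integral_weak_estimate u eq n) auto
    finally show "c * (LINT x|lborel. u x powr \<theta> * cutoff R n x)
      \<le> (4 * (real n)\<^sup>2 + 2 * real n * real CARD('n)) / R\<^sup>2 * (LINT x|lborel. u x * cutoff R (n - 2) x)" .
  qed (use n assms(6,7) cu u(2) in auto)
qed

text \<open>The same scheme with w = g(u)^2: \<open>integral_stable_estimate\<close> with H = f Y
  bounds the weighted integral and \<open>coercivity\<close> supplies the power \<theta>, for which
  2 \<theta> / (\<theta> - 1) is the stated bound. Positivity of g off 0 returns u = 0.\<close>

lemma (in profile) liouville_stable:
  fixes u :: "real ^ 'n \<Rightarrow> real"
  assumes u: "C2_space u" "\<And>x. u x \<ge> 0" "\<And>x. u x \<le> M" and eq: "\<And>x. - laplacian u x = f (u x)"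
    and st: "stable_solution f u"
    and dim: "real CARD('n) < 2 + 4 * (1 + \<beta>) / \<sigma>"
  shows "u x = 0"
proof -
  define \<theta> where "\<theta> = 1 + \<sigma> / (2 * (1 + \<beta>))"
  have \<theta>: "\<theta> > 1" using sigma_pos params by (simp add: \<theta>_def)
  obtain m where m: "m \<ge> 3" "real m \<le> real (m - 2) * \<theta>"
    using ex_cutoff_exponent[OF \<theta>] by blast
  \<comment> \<open>The exponents used below are 2 m and 2 m - 2 = 2 (m - 1), a weaker demand than
    the pair m and m - 2.\<close>
  have "real (m - 2) * \<theta> \<le> real (m - 1) * \<theta>" using \<theta> by (intro mult_right_mono) auto
  then have m1: "real (2 * m) \<le> real (2 * m - 2) * \<theta>" using m by (simp add: of_nat_diff algebra_simps)
  \<comment> \<open>\<open>coercivity\<close> asks for a positive upper end; |M| + 1 provides one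
    for every M.\<close>
  obtain c where c: "c > 0" "\<And>s. 0 \<le> s \<Longrightarrow> s \<le> \<bar>M\<bar> + 1 \<Longrightarrow> c * (g s)\<^sup>2 powr \<theta> \<le> f1 s * (g s)\<^sup>2 - f s * G s"
  proof -
    have "\<bar>M\<bar> + 1 > 0" by simp
    from coercivity[OF this, folded \<theta>_def] show ?thesis using that by blast
  qed
  have cu: "continuous_on UNIV u"
    using u(1) by (intro C1_space_continuous) (simp add: C2_space_def)
  have cont_g: "continuous_on {0..} g"
    unfolding g_def[abs_def] by (intro continuous_intros cont_f cont_k)
  have H: "f1 s * (g s)\<^sup>2 = f s * Y s" for s
    by (simp add: g_def Y_def power2_eq_square)
  \<comment> \<open>At s = 0 both sides vanish whatever the one-sided derivative is, since f and g
    do.\<close>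
  have H': "deriv_half_line f s * (g s)\<^sup>2 = f s * Y s" if "s \<ge> 0" for s
  proof (cases "s = 0")
    case True
    then show ?thesis by (simp add: g_0 f_0)
  next
    case False
    then have "s > 0" using that by simp
    moreover have "at s within {0..} = at s" using \<open>s > 0\<close> by (intro at_within_interior) auto
    ultimately have "deriv_half_line f s = f1 s"
      unfolding deriv_half_line_def
      using deriv_f[of s] by (simp add: has_real_derivative_iff_has_vector_derivative vector_derivative_at)
    then show ?thesis by (simp add: H)
  qed
  note comp = continuous_on_compose_nonneg[OF _ cu u(2)]
  have "(g (u x))\<^sup>2 = 0"
  proof (rule vanishing_of_cutoff_estimate[where w="\<lambda>x. (g (u x))\<^sup>2" and k="2 * m" and l="2 * m - 2"
        and c=c and C="20 * (real m)\<^sup>2 + 4 * real m * real CARD('n)" and \<theta>=\<theta>])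
    show "continuous_on UNIV (\<lambda>x. (g (u x))\<^sup>2)" by (intro continuous_intros comp cont_g)
    show "0 < 20 * (real m)\<^sup>2 + 4 * real m * real CARD('n)"
      using m by (intro add_pos_nonneg) auto
    have "2 * \<theta> / (\<theta> - 1) = 2 + 2 / (\<theta> - 1)" using \<theta> by (simp add: field_simps)
    moreover have "2 / (\<theta> - 1) = 4 * (1 + \<beta>) / \<sigma>" by (simp add: \<theta>_def)
    ultimately show "real DIM(real ^ 'n) < 2 * \<theta> / (\<theta> - 1)" using dim by simp
    fix R :: real assume R: "R \<ge> 1"
    have i1: "integrable lborel (\<lambda>x. (g (u x))\<^sup>2 powr \<theta> * cutoff R (2 * m) x)"
      by (rule integrable_compact_support[where R=R])
        (use R m \<theta> in \<open>auto intro!: continuous_intros continuous_on_powr' comp cont_g continuous_on_cutoff simp: cutoff_eq_0\<close>)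
    have i2: "integrable lborel (\<lambda>x. (f (u x) * Y (u x) - f (u x) * G (u x)) * cutoff R (2 * m) x)"
      by (rule integrable_compact_support[where R=R])
        (use R m in \<open>auto intro!: continuous_intros comp cont_f cont_Y cont_G continuous_on_cutoff simp: cutoff_eq_0\<close>)
    have le: "c * ((g (u x))\<^sup>2 powr \<theta>) \<le> f (u x) * Y (u x) - f (u x) * G (u x)" for x
      using c(2)[of "u x"] u(2)[of x] u(3)[of x] unfolding H by simp
    have "c * (LINT x|lborel. (g (u x))\<^sup>2 powr \<theta> * cutoff R (2 * m) x)
       = (LINT x|lborel. c * ((g (u x))\<^sup>2 powr \<theta> * cutoff R (2 * m) x))" by simp
    also have "\<dots> \<le> (LINT x|lborel. (f (u x) * Y (u x) - f (u x) * G (u x)) * cutoff R (2 * m) x)"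
    proof (rule integral_mono)
      fix x
      show "c * ((g (u x))\<^sup>2 powr \<theta> * cutoff R (2 * m) x)
        \<le> (f (u x) * Y (u x) - f (u x) * G (u x)) * cutoff R (2 * m) x"
        using mult_right_mono[OF le[of x] cutoff_nonneg[of R "2 * m" x]] by (simp add: mult.assoc)
    qed (use i1 i2 in auto)
    also have "\<dots> \<le> (20 * (real m)\<^sup>2 + 4 * real m * real CARD('n)) / R\<^sup>2
        * (LINT x|lborel. (g (u x))\<^sup>2 * cutoff R (2 * m - 2) x)"
      by (rule integral_stable_estimate[OF u(1,2) eq st deriv_g cont_g' deriv_G deriv_L abs_L_le H'])
        (use R m in \<open>auto intro!: continuous_intros cont_f cont_Y\<close>)
    finally show "c * (LINT x|lborel. (g (u x))\<^sup>2 powr \<theta> * cutoff R (2 * m) x)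
      \<le> (20 * (real m)\<^sup>2 + 4 * real m * real CARD('n)) / R\<^sup>2
        * (LINT x|lborel. (g (u x))\<^sup>2 * cutoff R (2 * m - 2) x)" .
  qed (use m m1 c(1) \<theta> in auto)
  then have "\<not> g (u x) > 0" by simp
  then show ?thesis using g_pos[of "u x"] u(2)[of x] by force
qed

section \<open>From the hypotheses to the locales and the dimension condition\<close>

lemma convex_nonlinearityI:
  assumes cont: "continuous_on {0..} f" and C2: "C2_on_pos f" and conv: "convex_on {0..} f"
    and pos: "\<And>s. s > 0 \<Longrightarrow> f s > 0" and f_0: "f 0 = 0"
  shows "convex_nonlinearity f (deriv f) (deriv (deriv f))"
proof
  fix s :: real assume s: "s > 0"
  have d1: "(f has_real_derivative deriv f t) (at t)" if "t > 0" for t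
    using C2 that by (auto simp: C2_on_pos_def C1_differentiable_on_eq DERIV_deriv_iff_real_differentiable)
  show "(f has_real_derivative deriv f s) (at s)" by (rule d1[OF s])
  show d2: "(deriv f has_real_derivative deriv (deriv f) s) (at s)"
    using C2 s by (auto simp: C2_on_pos_def C1_differentiable_on_eq DERIV_deriv_iff_real_differentiable)
  \<comment> \<open>The tangent at s, evaluated at 0 where f vanishes, gives f'(s) >= f(s) / s > 0;
    adding the tangent inequalities at two points gives monotonicity of f'.\<close>
  have tangent: "deriv f t * (x - t) \<le> f x - f t" if "t > 0" "x \<ge> 0" for t x
    by (rule convex_on_imp_above_tangent[OF conv]) (use that d1 in \<open>auto intro: has_field_derivative_at_within\<close>)
  show "deriv f s > 0"
  proof -
    have "0 < deriv f s * s" using tangent[OF s, of 0] pos[OF s] by (simp add: f_0)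
    then show ?thesis using s by (simp add: zero_less_mult_iff)
  qed
  have "mono_on {0<..} (deriv f)"
  proof (rule mono_onI)
    fix x y :: real assume xy: "x \<in> {0<..}" "y \<in> {0<..}" "x \<le> y"
    have "deriv f x * (y - x) \<le> f y - f x" "deriv f y * (x - y) \<le> f x - f y"
      using xy by (auto intro: tangent)
    then have "deriv f x * (y - x) \<le> deriv f y * (y - x)" by (simp add: algebra_simps)
    then show "deriv f x \<le> deriv f y" using xy(3) by (cases "x = y") auto
  qed
  then show "deriv (deriv f) s \<ge> 0"
    by (rule mono_on_imp_deriv_nonneg[OF _ d2]) (use s in \<open>simp add: interior_open\<close>)
qed (use assms in auto)

text \<open>The right side is 1 + (2 sqrt q + 1)^2, which equals 10 at q = 1; this separates N <= 9,
  N = 10 and N >= 11.\<close>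

lemma dimension_bound:
  fixes q :: real
  assumes "q \<ge> 1"
    and dim: "N \<le> 9 \<or> N = 10 \<and> q > 1 \<or> N \<ge> 11 \<and> q > 1 \<and> q / (q - 1) < p_crit N"
  shows "real N < 2 + 4 * q + 4 * sqrt q"
proof -
  have sq: "sqrt q \<ge> 1" using assms by simp
  consider "N \<le> 9" | "N = 10" "q > 1" | "N \<ge> 11" "q > 1" "q / (q - 1) < p_crit N" using dim by blast
  then show ?thesis
  proof cases
    case 1
    then have "real N \<le> 9" by simp
    then show ?thesis using assms(1) sq by linarith
  next
    case 2
    have "real N = 10" using 2 by simp
    then show ?thesis using sq 2(2) by linarith
  next
    case 3
    define s where "s = sqrt (real N - 1)"
    have N: "real N = s\<^sup>2 + 1" using 3 by (simp add: s_def)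
    have "s > 3" unfolding s_def using 3 by (intro real_less_rsqrt) auto
    \<comment> \<open>In terms of \<open>s = sqrt (N - 1)\<close> the critical exponent is \<open>(s - 1)^2 / ((s - 1)^2 - 4)\<close>, the
      conjugate of \<open>(s - 1)^2 / 4\<close>.\<close>
    have num: "(real N - 2)\<^sup>2 - 4 * real N + 8 * s = (s - 1)\<^sup>2 * ((s - 1) * (s + 3))"
      unfolding N by (simp add: power2_eq_square algebra_simps)
    have den: "(real N - 2) * (real N - 10) = ((s - 1)\<^sup>2 - 4) * ((s - 1) * (s + 3))"
      unfolding N by (simp add: power2_eq_square algebra_simps)
    have crit: "p_crit N = (s - 1)\<^sup>2 / ((s - 1)\<^sup>2 - 4)"
      unfolding p_crit_def s_def[symmetric] num den using \<open>s > 3\<close> by simp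
    have pos: "(s - 1)\<^sup>2 - 4 > 0"
    proof -
      have "2\<^sup>2 < (s - 1)\<^sup>2" using \<open>s > 3\<close> by (intro power_strict_mono) auto
      then show ?thesis by simp
    qed
    have "q * ((s - 1)\<^sup>2 - 4) < (s - 1)\<^sup>2 * (q - 1)"
      using 3 pos unfolding crit by (simp add: divide_simps mult.commute)
    then have "(s - 1)\<^sup>2 < 4 * q" by (simp add: algebra_simps)
    then have "(s - 1)\<^sup>2 < (2 * sqrt q)\<^sup>2" using assms(1) by (simp add: power_mult_distrib)
    then have "s - 1 < 2 * sqrt q" by (rule power_less_imp_less_base) (use sq in simp)
    then have "s\<^sup>2 < (2 * sqrt q + 1)\<^sup>2" using \<open>s > 3\<close> by (intro power_strict_mono) auto
    also have "\<dots> = 4 * q + 4 * sqrt q + 1"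
      using assms(1) by (simp add: power2_eq_square algebra_simps)
    finally show ?thesis using N by simp
  qed
qed

theorem theorem1p5:
  fixes f :: "real \<Rightarrow> real" and u :: "real ^ 'n \<Rightarrow> real" and q\<^sub>0 p\<^sub>0 :: ereal
  assumes "continuous_on {0..} f" and "C2_on_pos f"
    and "mono_on {0..} f" and "convex_on {0..} f"
    and "\<And>s. s > 0 \<Longrightarrow> f s > 0"
    and "(q_fun f \<longlongrightarrow> q\<^sub>0) (at_right 0)"
    and "p\<^sub>0 = conjugate_exponent q\<^sub>0"
    and "C2_space u" and "bounded (range u)" and "\<And>x. u x \<ge> 0"
    and "\<And>x. - laplacian u x = f (u x)"
    and "stable_solution f u"
    and "(1 \<le> CARD('n) \<and> CARD('n) \<le> 9) \<or>
         (CARD('n) = 10 \<and> p\<^sub>0 < \<infinity>) \<or>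
         (CARD('n) \<ge> 11 \<and> p\<^sub>0 < ereal (p_crit (CARD('n))))"
  shows "\<forall>x. u x = 0"
proof
  fix x
  obtain M where M: "\<And>x. u x \<le> M"
    using assms(9) by (auto simp: bounded_iff) (metis abs_le_D1)
  define N where "N = real CARD('n)"
  have N: "N \<ge> 1" by (simp add: N_def Suc_le_eq)
  have f0: "f 0 \<ge> 0"
  proof -
    have "(f \<longlongrightarrow> f 0) (at_right 0)"
      using assms(1) by (auto simp: continuous_on_def intro: tendsto_within_subset)
    moreover have "\<forall>\<^sub>F s in at_right 0. f s \<ge> 0"
      using assms(5) by (auto simp: eventually_at_right_less less_imp_le intro: eventually_at_rightI[of 0 1])
    ultimately show ?thesis by (intro tendsto_lowerbound) auto
  qed
  show "u x = 0"
  proof (cases "f 0 = 0")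
    case False
    \<comment> \<open>Here f >= f(0) > 0 by monotonicity, which beats a multiple of any positive
      power on the bounded range of u. The exponent 1 + 1 / N gives 2 \<theta> / (\<theta> - 1) = 2
      (N + 1) > N.\<close>
    define \<theta> where "\<theta> = 1 + 1 / N"
    have \<theta>: "\<theta> > 1" using N by (simp add: \<theta>_def)
    define K where "K = \<bar>M\<bar> powr \<theta> + 1"
    have "K > 0" by (simp add: K_def add_nonneg_pos)
    show ?thesis
    proof (rule liouville_supersolution[OF assms(8,10) M assms(11,1), of "f 0 / K" \<theta>])
      show "f 0 / K > 0" using False f0 \<open>K > 0\<close> by simp
      fix s assume s: "0 \<le> s" "s \<le> M"
      have "s powr \<theta> \<le> K" using powr_mono2[of \<theta> s "\<bar>M\<bar>"] s \<theta> by (simp add: K_def)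
      then have "f 0 / K * s powr \<theta> \<le> f 0 / K * K" using f0 \<open>K > 0\<close> by (intro mult_left_mono) auto
      also have "\<dots> \<le> f s" using \<open>K > 0\<close> s assms(3) by (simp add: mono_on_def)
      finally show "f 0 / K * s powr \<theta> \<le> f s" .
    next
      have "2 * \<theta> / (\<theta> - 1) = 2 * (N + 1)" using N by (simp add: \<theta>_def field_simps)
      then show "real CARD('n) < 2 * \<theta> / (\<theta> - 1)" using N by (simp add: N_def)
    qed (rule \<theta>)
  next
    case True
    interpret convex_nonlinearity f "deriv f" "deriv (deriv f)"
      by (rule convex_nonlinearityI[OF assms(1,2,4,5) True])
    \<comment> \<open>Passing from q to r = 1 / q gives real values: the default \<infinity> of q,
      taken when f'' = 0, becomes r = 0.\<close>
    define r where "r s = f s * deriv (deriv f) s / (deriv f s)\<^sup>2" for s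
    have q_inverse: "inverse (q_fun f s) = ereal (r s)" if "s > 0" for s
      using f_pos[OF that] f1_pos[OF that] by (auto simp: q_fun_def r_def)
    have q_nonneg: "q_fun f s \<ge> 0" if "s > 0" for s
      using f_pos[OF that] f2_nonneg[OF that] by (auto simp: q_fun_def)
    have ev_pos: "\<forall>\<^sub>F s in at_right 0. s > (0::real)" by (rule eventually_at_right_less)
    have q0: "q\<^sub>0 \<ge> 1"
    proof (rule ccontr)
      assume "\<not> ?thesis"
      then have "\<forall>\<^sub>F s in at_right 0. q_fun f s < 1"
        using assms(6) by (intro order_tendstoD) auto
      then obtain b where b: "b > 0" "\<And>s. 0 < s \<Longrightarrow> s < b \<Longrightarrow> q_fun f s < 1"
        by (auto simp: eventually_at_right_field)
      obtain s where s: "0 < s" "s \<le> b / 2" "f s * deriv (deriv f) s < (deriv f s)\<^sup>2"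
        using not_log_convex_near_0[of "b / 2"] b(1) by auto
      \<comment> \<open>A value below 1 is not the default \<infinity>, so it is the actual quotient
        and gives f'^2 < f f'', against the choice of s.\<close>
      have "q_fun f s < 1" using b s by auto
      moreover have "f s * deriv (deriv f) s \<ge> 0"
        using f_pos[OF s(1)] f2_nonneg[OF s(1)] by simp
      ultimately show False using s(3)
        by (auto simp: q_fun_def divide_simps split: if_splits)
    qed
    have lim: "((\<lambda>s. ereal (r s)) \<longlongrightarrow> inverse q\<^sub>0) (at_right 0)"
    proof (rule Lim_transform_eventually)
      show "((\<lambda>s. inverse (q_fun f s)) \<longlongrightarrow> inverse q\<^sub>0) (at_right 0)"
        using assms(6) eventually_mono[OF ev_pos q_nonneg] by (rule Extended_Real.tendsto_inverse_ereal)
      show "\<forall>\<^sub>F s in at_right 0. inverse (q_fun f s) = ereal (r s)"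
        using ev_pos by eventually_elim (rule q_inverse)
    qed
    show ?thesis
    proof (cases "q\<^sub>0 = \<infinity>")
      case True
      \<comment> \<open>Chosen so that 1 / (1 - \<sigma>) is again 1 + 1 / N.\<close>
      define \<sigma> where "\<sigma> = 1 / (N + 1)"
      have \<sigma>: "0 < \<sigma>" "\<sigma> < 1" using N by (auto simp: \<sigma>_def)
      define \<theta> where "\<theta> = 1 / (1 - \<sigma>)"
      have \<theta>: "\<theta> = 1 + 1 / N" using N by (simp add: \<theta>_def \<sigma>_def field_simps)
      have "(r \<longlongrightarrow> 0) (at_right 0)" using lim True by (simp add: zero_ereal_def)
      then have "\<forall>\<^sub>F s in at_right 0. r s < \<sigma>" using \<sigma> by (intro order_tendstoD) auto
      then obtain b where b: "b > 0" "\<And>s. 0 < s \<Longrightarrow> s < b \<Longrightarrow> r s < \<sigma>"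
        by (auto simp: eventually_at_right_field)
      have "f s * deriv (deriv f) s \<le> \<sigma> * (deriv f s)\<^sup>2" if "0 < s" "s \<le> b / 2" for s
        using b(2)[of s] b(1) that f1_pos[OF that(1)] by (simp add: r_def divide_simps)
      then obtain c where c: "c > 0" "\<And>s. 0 \<le> s \<Longrightarrow> s \<le> M \<Longrightarrow> c * s powr \<theta> \<le> f s"
        using f_ge_powr[of "b / 2" \<sigma> M] b(1) \<sigma> unfolding \<theta>_def by auto
      show ?thesis
      proof (rule liouville_supersolution[OF assms(8,10) M assms(11,1) c(1) _ c(2)])
        show "\<theta> > 1" using N by (simp add: \<theta>)
        have "2 * \<theta> / (\<theta> - 1) = 2 * (N + 1)" using N by (simp add: \<theta> field_simps)
        then show "real CARD('n) < 2 * \<theta> / (\<theta> - 1)" using N by (simp add: N_def)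
      qed
    next
      case False
      then obtain q where q: "q\<^sub>0 = ereal q" "q \<ge> 1" using q0 by (cases q\<^sub>0) auto
      have "real CARD('n) < 2 + 4 * q + 4 * sqrt q"
      proof (rule dimension_bound[OF q(2)])
        \<comment> \<open>For q = 1 the conjugate exponent is \<infinity>, so either strict upper
          bound on \<open>p\<^sub>0\<close> forces q > 1.\<close>
        have conj: "conjugate_exponent q\<^sub>0 = (if q = 1 then \<infinity> else ereal (q / (q - 1)))"
          using q by (auto simp: conjugate_exponent_def one_ereal_def)
        show "CARD('n) \<le> 9 \<or> CARD('n) = 10 \<and> q > 1 \<or> CARD('n) \<ge> 11 \<and> q > 1 \<and> q / (q - 1) < p_crit CARD('n)"
          using assms(13) q(2) unfolding assms(7) conj by (auto split: if_splits)
      qed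
      moreover have "4 * (1 + sqrt (1 / q)) / (1 / q) = 4 * q + 4 * sqrt q"
      proof -
        have "4 * (1 + sqrt (1 / q)) / (1 / q) = 4 * q + 4 * (q / sqrt q)"
          by (simp add: real_sqrt_divide algebra_simps)
        also have "q / sqrt q = sqrt q" using q(2) by (simp add: real_div_sqrt)
        finally show ?thesis .
      qed
      ultimately have dim: "N < 2 + 4 * (1 + sqrt (1 / q)) / (1 / q)"
        by (simp only: N_def)
      define \<rho> where "\<rho> = 1 / q"
      have "\<rho> > 0" using q by (simp add: \<rho>_def)
      \<comment> \<open>The dimension bound is strict at \<eta> = 0, so by continuity it survives
        for some \<eta> > 0 with sqrt \<rho> - \<eta> as \<beta> and \<rho> + \<eta> as
        \<sigma>.\<close>
      have "((\<lambda>\<eta>. 2 + 4 * (1 + (sqrt \<rho> - \<eta>)) / (\<rho> + \<eta>)) \<longlongrightarrow> 2 + 4 * (1 + (sqrt \<rho> - 0)) / (\<rho> + 0)) (at_right 0)"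
        using \<open>\<rho> > 0\<close>
        by (intro tendsto_add tendsto_divide tendsto_mult tendsto_diff tendsto_const tendsto_ident_at) auto
      then have "\<forall>\<^sub>F \<eta> in at_right 0. N < 2 + 4 * (1 + (sqrt \<rho> - \<eta>)) / (\<rho> + \<eta>)"
        using dim by (intro order_tendstoD(1)) (auto simp: \<rho>_def)
      moreover have "\<forall>\<^sub>F \<eta> in at_right 0. \<eta> < sqrt \<rho>"
        using \<open>\<rho> > 0\<close> by (intro eventually_at_rightI[of 0 "sqrt \<rho>"]) auto
      ultimately have "\<forall>\<^sub>F \<eta> in at_right 0. \<eta> > 0 \<and> \<eta> < sqrt \<rho> \<and> N < 2 + 4 * (1 + (sqrt \<rho> - \<eta>)) / (\<rho> + \<eta>)"
        using ev_pos by eventually_elim auto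
      then obtain \<eta> where \<eta>: "\<eta> > 0" "\<eta> < sqrt \<rho>" "N < 2 + 4 * (1 + (sqrt \<rho> - \<eta>)) / (\<rho> + \<eta>)"
        using eventually_happens'[OF trivial_limit_at_right_real] by blast
      define \<beta> where "\<beta> = sqrt \<rho> - \<eta>"
      \<comment> \<open>Half of the gap, so that \<beta>^2 + \<epsilon> stays strictly below
        \<rho>.\<close>
      define \<epsilon> where "\<epsilon> = (\<rho> - \<beta>\<^sup>2) / 2"
      have "\<beta> > 0" using \<eta> by (simp add: \<beta>_def)
      have "\<beta>\<^sup>2 < (sqrt \<rho>)\<^sup>2" using \<eta> \<open>\<beta> > 0\<close> by (intro power_strict_mono) (auto simp: \<beta>_def)
      then have "\<epsilon> > 0" "\<beta>\<^sup>2 + \<epsilon> < \<rho>" using \<open>\<rho> > 0\<close> by (auto simp: \<epsilon>_def field_simps)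
      have "(r \<longlongrightarrow> \<rho>) (at_right 0)"
        using lim q by (simp add: \<rho>_def inverse_eq_divide)
      then have "\<forall>\<^sub>F s in at_right 0. \<beta>\<^sup>2 + \<epsilon> < r s" "\<forall>\<^sub>F s in at_right 0. r s < \<rho> + \<eta>"
        using \<open>\<beta>\<^sup>2 + \<epsilon> < \<rho>\<close> \<eta>(1) by (auto intro: order_tendstoD)
      then have "\<forall>\<^sub>F s in at_right 0. \<beta>\<^sup>2 + \<epsilon> < r s \<and> r s < \<rho> + \<eta>"
        by (rule eventually_conj)
      then obtain b where b: "b > 0" "\<And>s. 0 < s \<Longrightarrow> s < b \<Longrightarrow> \<beta>\<^sup>2 + \<epsilon> < r s \<and> r s < \<rho> + \<eta>"
        by (auto simp: eventually_at_right_field)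
      \<comment> \<open>The bounds on r hold on the open interval (0, b), while the locale includes
        the right end \<delta>; hence b / 2.\<close>
      interpret profile f "deriv f" "deriv (deriv f)" \<beta> \<epsilon> "\<rho> + \<eta>" "b / 2"
      proof
        fix s assume s: "0 < s" "s \<le> b / 2"
        have r: "f s * deriv (deriv f) s = r s * (deriv f s)\<^sup>2" using f1_pos[OF s(1)] by (simp add: r_def)
        have "\<beta>\<^sup>2 + \<epsilon> \<le> r s" "r s \<le> \<rho> + \<eta>" using b(2)[of s] b(1) s by auto
        then show "(\<beta>\<^sup>2 + \<epsilon>) * (deriv f s)\<^sup>2 \<le> f s * deriv (deriv f) s"
          "f s * deriv (deriv f) s \<le> (\<rho> + \<eta>) * (deriv f s)\<^sup>2"
          unfolding r by (auto intro!: mult_right_mono)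
      qed (use \<open>\<beta> > 0\<close> \<open>\<epsilon> > 0\<close> b(1) in auto)
      show ?thesis
        by (rule liouville_stable[OF assms(8,10) M assms(11,12)])
          (use \<eta>(3) in \<open>simp add: N_def \<beta>_def\<close>)
    qed
  qed
qed

end
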